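(* For each $p\in(0,1)$, let $(\mathcal{G}_x)_{x\in\mathbb{Z}^2}$ be i.i.d. with $\mathcal{G}_x=\{e_1,-e_1,-e_2\}$ with probability $p$ and $\mathcal{G}_x=\{e_1,-e_1\}$ with probability $1-p$. Then the random walk $(X_n)$ in the associated uniform random environment, started at the origin, satisfies $P(n^{-1}X_n\to v)=1$ for a deterministic $v=v(p)=(v^{[1]}(p),v^{[2]}(p))$ with $v^{[1]}(p)=0$ and $v^{[2]}(p)<0$ for every $p\in(0,1)$, and the function $p\mapsto v^{[2]}(p)$ is strictly decreasing on $(0,1)$.
   Context: $e_1=(1,0)$ and $e_2=(0,1)$ are the unit vectors of $\mathbb{Z}^2$. Given a realization of the i.i.d. non-empty sets $(\mathcal{G}_x)_{x\in\mathbb{Z}^2}$, each a subset of $\{\pm e_1,\pm e_2\}$, the walk in the associated uniform random environment is the time-homogeneous Markov chain $(X_n)_{n\ge0}$ on $\mathbb{Z}^2$ with $X_0=0$ that moves from $x$ to $x+e$ with probability $1/|\mathcal{G}_x|$ if $e\in\mathcal{G}_x$, and with probability $0$ otherwise. The environment is sampled once and kept fixed. $P$ denotes the annealed law (depending on $p$), i.e. the law of the walk averaged over the environment. *)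

theory Defs
  imports "HOL-Probability.Probability"
begin

type_synonym site = "int \<times> int"

definition e1 :: site where "e1 = (1, 0)"

definition e2 :: site where "e2 = (0, 1)"

definition environment :: "site set pmf \<Rightarrow> (site \<Rightarrow> site set) measure" where
  "environment \<mu> = (\<Pi>\<^sub>M x\<in>UNIV. measure_pmf \<mu>)"

definition transition :: "(site \<Rightarrow> site set) \<Rightarrow> site \<Rightarrow> site pmf" where
  "transition G x = map_pmf (\<lambda>e. x + e) (pmf_of_set (G x))"

definition path_space :: "(nat \<Rightarrow> site) measure" where
  "path_space = (\<Pi>\<^sub>M n\<in>UNIV. count_space UNIV)"

text \<open>
  The conditional law of the position at time \<open>n\<close> given the positions \<open>h 0, \<dots>, h (n - 1)\<close>.
  The quenched law is the law on path space that the Ionescu-Tulcea theorem attaches to these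
  kernels; \<open>quenched_cylinder\<close> below spells out its finite-dimensional marginals.
\<close>

definition step_kernel :: "(site \<Rightarrow> site set) \<Rightarrow> nat \<Rightarrow> (nat \<Rightarrow> site) \<Rightarrow> site measure" where
  "step_kernel G n h =
    (if n = 0 then return (count_space UNIV) 0 else measure_pmf (transition G (h (n - 1))))"

definition quenched :: "(site \<Rightarrow> site set) \<Rightarrow> (nat \<Rightarrow> site) measure" where
  "quenched G = projective_family.lim UNIV
     (Ionescu_Tulcea.CI (step_kernel G) (\<lambda>_. count_space UNIV)) (\<lambda>_. count_space UNIV)"

definition annealed :: "site set pmf \<Rightarrow> (nat \<Rightarrow> site) measure" where
  "annealed \<mu> = environment \<mu> \<bind> quenched"

definition real_site :: "site \<Rightarrow> real \<times> real" where
  "real_site x = (real_of_int (fst x), real_of_int (snd x))"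

definition step_set_law :: "real \<Rightarrow> site set pmf" where
  "step_set_law p =
    map_pmf (\<lambda>b. if b then {e1, - e1, - e2} else {e1, - e1}) (bernoulli_pmf p)"


text \<open>
  The quenched law is the law of the Markov chain, and it depends measurably on the environment,
  so that the mixture over environments is a genuine probability measure.
\<close>

lemma Ionescu_Tulcea_step_kernel:
  "Ionescu_Tulcea (step_kernel G) (\<lambda>_. count_space UNIV)"
proof (rule Ionescu_Tulcea.intro)
  fix n
  show "step_kernel G n \<in> (\<Pi>\<^sub>M i\<in>{0..<n}. count_space UNIV) \<rightarrow>\<^sub>M subprob_algebra (count_space UNIV)"
  proof (cases "n = 0")
    case True
    then have "step_kernel G n = (\<lambda>_. return (count_space UNIV) 0)"
      by (auto simp: step_kernel_def)
    then show ?thesis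
      by (auto intro!: measurable_const simp: space_subprob_algebra subprob_space_return)
  next
    case False
    then have eq: "step_kernel G n = (\<lambda>h. measure_pmf (transition G (h (n - 1))))"
      by (auto simp: step_kernel_def)
    have c: "(\<lambda>h. h (n - 1)) \<in> (\<Pi>\<^sub>M i\<in>{0..<n}. count_space UNIV) \<rightarrow>\<^sub>M (count_space UNIV :: site measure)"
      using False by (intro measurable_component_singleton) auto
    have "(\<lambda>x. measure_pmf (transition G x)) \<in> count_space UNIV \<rightarrow>\<^sub>M subprob_algebra (count_space UNIV)"
      by (auto simp: measurable_count_space_eq1 space_subprob_algebra
            intro!: prob_space_imp_subprob_space measure_pmf.prob_space_axioms)
    from measurable_compose[OF c this] show ?thesis unfolding eq .
  qed
next
  show "prob_space (step_kernel G n h)" for n h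
    by (auto simp: step_kernel_def intro!: prob_space_return measure_pmf.prob_space_axioms)
qed

interpretation walk: Ionescu_Tulcea "step_kernel G" "\<lambda>_. count_space UNIV" for G
  by (rule Ionescu_Tulcea_step_kernel)

lemma quenched_eq: "quenched G = walk.PF.lim G"
  by (simp add: quenched_def)

lemma sets_quenched [simp, measurable_cong]: "sets (quenched G) = sets path_space"
  by (simp add: quenched_eq path_space_def)

lemma space_path_space [simp]: "space path_space = UNIV"
  by (simp add: path_space_def space_PiM)

lemma space_quenched [simp]: "space (quenched G) = UNIV"
  using sets_eq_imp_space_eq[OF sets_quenched] by simp

lemma prob_space_quenched: "prob_space (quenched G)"
proof
  have "emeasure (walk.PF.lim G) (walk.PF.emb UNIV {} {\<lambda>_. undefined}) =
        emeasure (walk.CI G {}) {\<lambda>_. undefined}"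
    by (intro walk.lim) (auto simp: sets_PiM_empty)
  moreover interpret C: prob_space "walk.CI G {}"
    by (rule walk.PF.prob_space_P) auto
  have "space (walk.CI G {}) = {\<lambda>_. undefined}"
    by (simp add: walk.CI_def space_PiM_empty)
  ultimately show "emeasure (quenched G) (space (quenched G)) = 1"
    using C.emeasure_space_1 by (simp add: quenched_eq[symmetric] prod_emb_def vimage_def restrict_def)
qed

lemma sets_PiM_singleton:
  fixes k :: nat
  shows "{restrict x {0..<k}} \<in> sets (\<Pi>\<^sub>M i\<in>{0..<k}. (count_space UNIV :: site measure))"
proof -
  have "(\<Pi>\<^sub>E i\<in>{0..<k}. {restrict x {0..<k} i}) = {restrict x {0..<k}}"
    by (intro PiE_singleton restrict_extensional)
  moreover have "(\<Pi>\<^sub>E i\<in>{0..<k}. {restrict x {0..<k} i})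
      \<in> sets (\<Pi>\<^sub>M i\<in>{0..<k}. (count_space UNIV :: site measure))"
    by (intro sets_PiM_I_finite) (auto simp del: restrict_apply)
  ultimately show ?thesis by simp
qed

lemma emeasure_C_path:
  "emeasure (walk.C G 0 n (\<lambda>_. undefined)) {restrict x {0..<n}} =
    (\<Prod>i<n. emeasure (step_kernel G i (restrict x {0..<i})) {x i})"
proof (induction n)
  case 0
  show ?case
    using sets_PiM_singleton[of x 0] by (simp add: restrict_def)
next
  case (Suc n)
  let ?P = "\<lambda>n. \<Pi>\<^sub>M i\<in>{0..<n}. (count_space UNIV :: site measure)"
  let ?u = "(\<lambda>_. undefined) :: nat \<Rightarrow> site"
  note sing = sets_PiM_singleton[of x]
  have eP: "emeasure (walk.eP G n h) {restrict x {0..<Suc n}} =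
      emeasure (step_kernel G n (restrict x {0..<n})) {x n} * indicator {restrict x {0..<n}} h"
    if h: "h \<in> space (?P n)" for h
  proof -
    have hext: "h \<in> extensional {0..<n}"
      using h by (auto simp: space_PiM PiE_def)
    have "(fun_upd h n -` {restrict x {0..<Suc n}}) \<inter> space (count_space UNIV) =
       (if h = restrict x {0..<n} then {x n} else {})"
    proof -
      have "h(n := y) = restrict x {0..<Suc n} \<longleftrightarrow> h = restrict x {0..<n} \<and> y = x n" for y
      proof
        assume eq: "h(n := y) = restrict x {0..<Suc n}"
        have "h i = restrict x {0..<n} i" for i
          using fun_cong[OF eq, of i] hext by (auto simp: extensional_def split: if_splits)
        moreover have "y = x n" using fun_cong[OF eq, of n] by auto
        ultimately show "h = restrict x {0..<n} \<and> y = x n" by auto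
      qed (auto simp: fun_eq_iff less_Suc_eq)
      then show ?thesis by auto
    qed
    then show ?thesis
      using walk.emeasure_eP[OF h sing] by (auto simp: indicator_def)
  qed
  have "emeasure (walk.C G 0 (Suc n) ?u) {restrict x {0..<Suc n}} =
      (\<integral>\<^sup>+h. emeasure (walk.eP G n h) {restrict x {0..<Suc n}} \<partial>walk.C G 0 n ?u)"
    using walk.measurable_eP[of G n] sing[of "Suc n"]
    by (simp del: walk.measurable_eP, subst emeasure_bind[where N = "?P (Suc n)"])
       (auto simp: walk.space_C space_PiM_empty walk.sets_C cong: measurable_cong_sets)
  also have "\<dots> = (\<integral>\<^sup>+h. emeasure (step_kernel G n (restrict x {0..<n})) {x n} *
      indicator {restrict x {0..<n}} h \<partial>walk.C G 0 n ?u)"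
    by (intro nn_integral_cong eP) (simp add: walk.space_C space_PiM_empty)
  also have "\<dots> = emeasure (step_kernel G n (restrict x {0..<n})) {x n} *
      emeasure (walk.C G 0 n ?u) {restrict x {0..<n}}"
    using sing[of n] by (intro nn_integral_cmult_indicator) (simp add: walk.sets_C space_PiM_empty)
  finally show ?case
    by (simp only: Suc.IH prod.lessThan_Suc mult.commute)
qed

lemma quenched_cylinder:
  "measure (quenched G) {X. \<forall>i\<le>n. X i = x i} =
    of_bool (x 0 = 0) * (\<Prod>i<n. pmf (transition G (x i)) (x (Suc i)))"
proof -
  let ?P = "\<Pi>\<^sub>M i\<in>{0..<Suc n}. (count_space UNIV :: site measure)"
  let ?A = "{restrict x {0..<Suc n}}"
  have A: "?A \<in> sets ?P" by (rule sets_PiM_singleton)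
  have "{X. \<forall>i\<le>n. X i = x i} = walk.PF.emb UNIV {0..<Suc n} ?A"
    by (auto simp: prod_emb_def space_PiM fun_eq_iff restrict_def less_Suc_eq_le) metis
  then have "emeasure (quenched G) {X. \<forall>i\<le>n. X i = x i} = emeasure (walk.CI G {0..<Suc n}) ?A"
    using walk.lim[OF _ A, of G] by (simp add: quenched_eq)
  also have "\<dots> = emeasure (walk.C G 0 (Suc n) (\<lambda>_. undefined)) ?A"
    using walk.emeasure_CI[OF order_refl A, of G]
    by (subst (asm) prod_emb_id) (auto simp: PiE_def simp del: walk.C.simps)
  also have "\<dots> = (\<Prod>i<Suc n. emeasure (step_kernel G i (restrict x {0..<i})) {x i})"
    by (rule emeasure_C_path)
  also have "\<dots> = ennreal (of_bool (x 0 = 0)) * (\<Prod>i<n. ennreal (pmf (transition G (x i)) (x (Suc i))))"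
    by (subst prod.lessThan_Suc_shift)
       (auto simp: step_kernel_def emeasure_pmf_single indicator_def intro!: prod.cong)
  also have "\<dots> = ennreal (of_bool (x 0 = 0) * (\<Prod>i<n. pmf (transition G (x i)) (x (Suc i))))"
    by (simp add: prod_ennreal ennreal_mult'' prod_nonneg)
  finally show ?thesis
    by (simp add: measure_def prod_nonneg)
qed

lemma pmf_transition:
  assumes "G x \<noteq> {}" "finite (G x)"
  shows "pmf (transition G x) (x + e) = (if e \<in> G x then 1 / real (card (G x)) else 0)"
proof -
  have "pmf (transition G x) (x + e) = pmf (pmf_of_set (G x)) e"
    unfolding transition_def by (rule pmf_map_inj') (auto simp: inj_on_def)
  then show ?thesis
    using assms by (simp add: indicator_def)
qed

lemma measurable_step_kernel:
  "(\<lambda>(G, h). step_kernel G n h) \<in> environment \<mu> \<Otimes>\<^sub>M (\<Pi>\<^sub>M i\<in>{0..<n}. count_space UNIV)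
    \<rightarrow>\<^sub>M subprob_algebra (count_space UNIV)"
proof (cases "n = 0")
  case True
  then have "(\<lambda>(G, h). step_kernel G n h) = (\<lambda>_. return (count_space UNIV) 0)"
    by (auto simp: step_kernel_def)
  then show ?thesis
    by (auto intro!: measurable_const simp: space_subprob_algebra subprob_space_return)
next
  case False
  let ?E = "environment \<mu> \<Otimes>\<^sub>M (\<Pi>\<^sub>M i\<in>{0..<n}. (count_space UNIV :: site measure))"
  have eq: "(\<lambda>(G, h). step_kernel G n h) =
      (\<lambda>z. measure_pmf (transition (fst z) (snd z (n - 1))))"
    using False by (auto simp: step_kernel_def fun_eq_iff)
  have c: "(\<lambda>z. snd z (n - 1)) \<in> ?E \<rightarrow>\<^sub>M (count_space UNIV :: site measure)"
    using False by (intro measurable_compose[OF measurable_snd measurable_component_singleton]) auto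
  have d: "(\<lambda>z. measure_pmf (transition (fst z) x)) \<in> ?E \<rightarrow>\<^sub>M subprob_algebra (count_space UNIV)" for x
  proof -
    have 1: "(\<lambda>z. fst z x) \<in> ?E \<rightarrow>\<^sub>M measure_pmf \<mu>"
      unfolding environment_def
      by (intro measurable_compose[OF measurable_fst measurable_component_singleton]) auto
    have 2: "(\<lambda>S. measure_pmf (map_pmf (\<lambda>e. x + e) (pmf_of_set S))) \<in>
        measure_pmf \<mu> \<rightarrow>\<^sub>M subprob_algebra (count_space UNIV)"
      by (auto simp: space_subprob_algebra
            intro!: prob_space_imp_subprob_space measure_pmf.prob_space_axioms)
    show ?thesis
      using measurable_compose[OF 1 2] by (simp add: transition_def)
  qed
  show ?thesis
    unfolding eq by (rule measurable_compose_countable[OF d c])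
qed

lemma measurable_eP_joint:
  "(\<lambda>(G, h). walk.eP G n h) \<in> environment \<mu> \<Otimes>\<^sub>M (\<Pi>\<^sub>M i\<in>{0..<n}. count_space UNIV)
    \<rightarrow>\<^sub>M subprob_algebra (\<Pi>\<^sub>M i\<in>{0..<Suc n}. count_space UNIV)"
proof -
  let ?E = "environment \<mu> \<Otimes>\<^sub>M (\<Pi>\<^sub>M i\<in>{0..<n}. (count_space UNIV :: site measure))"
  have "(\<lambda>z. distr (case z of (G, h) \<Rightarrow> step_kernel G n h)
      (\<Pi>\<^sub>M i\<in>{0..<Suc n}. count_space UNIV) (fun_upd (snd z) n))
    \<in> ?E \<rightarrow>\<^sub>M subprob_algebra (\<Pi>\<^sub>M i\<in>{0..<Suc n}. count_space UNIV)"
  proof (rule measurable_distr2[OF _ measurable_step_kernel])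
    show "(\<lambda>(z, y). (snd z)(n := y)) \<in> ?E \<Otimes>\<^sub>M count_space UNIV
        \<rightarrow>\<^sub>M (\<Pi>\<^sub>M i\<in>{0..<Suc n}. count_space UNIV)"
      unfolding split_beta
      by (rule measurable_fun_upd[where J = "{0..<n}"]) (auto simp: atLeast0_lessThan_Suc)
  qed
  then show ?thesis
    by (simp add: walk.eP_def split_beta)
qed

lemma measurable_C_joint:
  "(\<lambda>G. walk.C G 0 n (\<lambda>_. undefined)) \<in> environment \<mu>
    \<rightarrow>\<^sub>M subprob_algebra (\<Pi>\<^sub>M i\<in>{0..<n}. count_space UNIV)"
proof (induction n)
  case 0
  show ?case
    by (auto intro!: measurable_const subprob_space_return simp: space_subprob_algebra space_PiM)
next
  case (Suc n)
  show ?case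
    using measurable_bind'[OF Suc measurable_eP_joint] by simp
qed

lemma measurable_quenched:
  "quenched \<in> environment \<mu> \<rightarrow>\<^sub>M subprob_algebra path_space"
proof (rule measurable_subprob_algebra_generated[where \<Omega> = UNIV and
      G = "prod_algebra UNIV (\<lambda>_::nat. count_space (UNIV :: site set))"])
  show "sets path_space =
      sigma_sets UNIV (prod_algebra UNIV (\<lambda>_::nat. count_space (UNIV :: site set)))"
    by (simp add: path_space_def sets_PiM)
  show "Int_stable (prod_algebra UNIV (\<lambda>_::nat. count_space (UNIV :: site set)))"
    by (rule Int_stable_prod_algebra)
  show "(\<lambda>G. emeasure (quenched G) UNIV) \<in> borel_measurable (environment \<mu>)"
    using prob_space.emeasure_space_1[OF prob_space_quenched] by simp
next
  fix A assume "A \<in> prod_algebra UNIV (\<lambda>_::nat. count_space (UNIV :: site set))"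
  then obtain J E where A: "A = walk.PF.emb UNIV J (Pi\<^sub>E J E)" and J: "finite J"
    by (auto elim!: prod_algebraE)
  let ?X = "Pi\<^sub>E J E" and ?n = "walk.up_to J"
  have X: "?X \<in> sets (\<Pi>\<^sub>M i\<in>J. count_space UNIV)"
    using J by (intro sets_PiM_I_finite) auto
  have "emeasure (quenched G) A =
      emeasure (walk.C G 0 ?n (\<lambda>_. undefined)) (walk.PF.emb {0..<?n} J ?X)" for G
    using walk.lim[OF J X] walk.emeasure_CI'[OF J X] by (simp add: quenched_eq A)
  moreover have "walk.PF.emb {0..<?n} J ?X \<in> sets (\<Pi>\<^sub>M i\<in>{0..<?n}. count_space UNIV)"
    using X walk.up_to[OF J] by (intro measurable_prod_emb) auto
  ultimately show "(\<lambda>G. emeasure (quenched G) A) \<in> borel_measurable (environment \<mu>)"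
    using measurable_emeasure_kernel[OF measurable_C_joint] by simp
qed (auto intro!: prob_space_imp_subprob_space prob_space_quenched)

lemma prob_space_annealed: "prob_space (annealed \<mu>)"
proof -
  interpret environment: prob_space "environment \<mu>"
    unfolding environment_def by (intro prob_space_PiM measure_pmf.prob_space_axioms)
  show ?thesis
    unfolding annealed_def
    by (intro environment.prob_space_bind[where S = path_space] AE_I2 prob_space_quenched
          measurable_quenched)
qed

lemma sets_annealed: "sets (annealed \<mu>) = sets path_space"
  unfolding annealed_def
  by (rule sets_bind) (auto simp: environment_def space_PiM)

lemma emeasure_annealed:
  assumes "A \<in> sets path_space"
  shows "emeasure (annealed \<mu>) A = (\<integral>\<^sup>+G. emeasure (quenched G) A \<partial>environment \<mu>)"
  unfolding annealed_def using assms
  by (intro emeasure_bind[where N = path_space] measurable_quenched)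
     (auto simp: environment_def space_PiM)

end

theory Submission
  imports Defs "HOL-Real_Asymp.Real_Asymp" "HOL-Library.Discrete_Functions"
begin

text \<open>
  The walk never returns to a row it has left, so under the annealed law the times spent in
  successive rows are i.i.d. copies of a time \<open>T\<close>, and the vertical speed is \<open>-1 / E T\<close>.
  Inside a row the walk is a simple random walk killed with probability 1/3 at each visit to a
  drilled site. Hence \<open>P(T > n)\<close> is the expectation over simple random walk of the product, over the
  visited sites \<open>y\<close>, of \<open>1 - p + p (2/3)^l(y)\<close> with \<open>l(y)\<close> the number of visits to \<open>y\<close> in \<open>n\<close> steps.
  This is decreasing in \<open>p\<close>, strictly for \<open>n = 1\<close>, so \<open>E T\<close> is strictly decreasing.
  The product is at most \<open>(1 - p/3)^R\<close> with \<open>R\<close> the number of visited sites, and an explicit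
  supersolution for the walk together with its visited interval bounds the second moment of \<open>T\<close>.
  Chebyshev's inequality for sums of copies of \<open>T\<close> and for the horizontal martingale gives deviation
  probabilities of order \<open>1/n\<close>. These are summable along the squares, and bounded increments fill
  the gaps.
\<close>

section \<open>One-time marginals of the quenched walk\<close>

text \<open>The target type is countable, so it suffices that the preimage of each single list is a
  finite-dimensional cylinder.\<close>

lemma measurable_history:
  "(\<lambda>X. map X (rev [0..<n])) \<in> path_space \<rightarrow>\<^sub>M count_space (UNIV :: site list set)"
proof (subst measurable_count_space_eq2_countable, safe)
  fix l :: "site list"
  have [measurable]: "(\<lambda>X. X i) \<in> path_space \<rightarrow>\<^sub>M (count_space UNIV :: site measure)" for i
    by (simp add: path_space_def)
  have "{X \<in> space path_space. length l = n \<and> (\<forall>i\<in>{..<n}. X i = l ! (n - Suc i))} \<in> sets path_space"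
    by measurable
  also have "{X \<in> space path_space. length l = n \<and> (\<forall>i\<in>{..<n}. X i = l ! (n - Suc i))} =
      (\<lambda>X. map X (rev [0..<n])) -` {l} \<inter> space path_space"
  proof -
    have "map X (rev [0..<n]) = l \<longleftrightarrow> length l = n \<and> (\<forall>i<n. X i = l ! (n - Suc i))" for X
    proof
      assume *: "length l = n \<and> (\<forall>i<n. X i = l ! (n - Suc i))"
      show "map X (rev [0..<n]) = l"
        using * by (intro nth_equalityI) (auto simp: rev_nth)
    next
      assume "map X (rev [0..<n]) = l"
      then show "length l = n \<and> (\<forall>i<n. X i = l ! (n - Suc i))"
        by (auto simp: rev_nth)
    qed
    then show ?thesis by auto
  qed
  finally show "(\<lambda>X. map X (rev [0..<n])) -` {l} \<inter> space path_space \<in> sets path_space" .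
qed auto

text \<open>Histories are kept newest first: one more step is a Cons and the current site is
  \<open>hd\<close>.\<close>

primrec history_pmf :: "(site \<Rightarrow> site set) \<Rightarrow> nat \<Rightarrow> site list pmf" where
  "history_pmf G 0 = return_pmf [0]"
| "history_pmf G (Suc n) =
    bind_pmf (history_pmf G n) (\<lambda>l. map_pmf (\<lambda>y. y # l) (transition G (hd l)))"

lemma pmf_history_Cons:
  "pmf (history_pmf G (Suc n)) (y # l) = pmf (history_pmf G n) l * pmf (transition G (hd l)) y"
proof -
  have "pmf (map_pmf (\<lambda>y. y # l') (transition G (hd l'))) (y # l) =
      indicator {l} l' * pmf (transition G (hd l)) y" for l'
  proof (cases "l' = l")
    case True
    then show ?thesis
      using pmf_map_inj'[of "\<lambda>y. y # l" "transition G (hd l)" y] by (auto simp: inj_on_def)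
  next
    case False
    then show ?thesis by (auto simp: pmf_map vimage_def)
  qed
  then show ?thesis
    by (simp add: pmf_bind measure_pmf_single)
qed

lemma length_history: "l \<in> set_pmf (history_pmf G n) \<Longrightarrow> length l = Suc n"
  by (induction n arbitrary: l) auto

lemma pmf_history:
  "pmf (history_pmf G n) (map x (rev [0..<Suc n])) =
    of_bool (x 0 = 0) * (\<Prod>i<n. pmf (transition G (x i)) (x (Suc i)))"
proof (induction n)
  case (Suc n)
  have "map x (rev [0..<Suc (Suc n)]) = x (Suc n) # map x (rev [0..<Suc n])" by simp
  then show ?case
    using Suc by (simp only: pmf_history_Cons) simp
qed (auto simp: indicator_def)

text \<open>Both laws live on a countable type and are compared on singletons.
  \<open>quenched_cylinder\<close> gives the mass of a list of the right length; any other list has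
  mass 0 on both sides.\<close>

lemma distr_history:
  "distr (quenched G) (count_space UNIV) (\<lambda>X. map X (rev [0..<Suc n])) = measure_pmf (history_pmf G n)"
proof (rule measure_eqI_countable)
  interpret Q: prob_space "quenched G" by (rule prob_space_quenched)
  have m: "(\<lambda>X. map X (rev [0..<Suc n])) \<in> quenched G \<rightarrow>\<^sub>M count_space (UNIV :: site list set)"
    using measurable_history by (simp del: upt_Suc)
  fix l :: "site list"
  show "emeasure (distr (quenched G) (count_space UNIV) (\<lambda>X. map X (rev [0..<Suc n]))) {l} =
      emeasure (measure_pmf (history_pmf G n)) {l}"
  proof (cases "length l = Suc n")
    case True
    define x where "x i = l ! (n - i)" for i
    have l: "l = map x (rev [0..<Suc n])"
      using True by (intro nth_equalityI) (auto simp: x_def rev_nth simp del: upt_Suc)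
    have "map X (rev [0..<Suc n]) = l \<longleftrightarrow> (\<forall>i\<le>n. X i = x i)" for X
      unfolding l by (auto simp: less_Suc_eq_le simp del: upt_Suc)
    then have "(\<lambda>X. map X (rev [0..<Suc n])) -` {l} = {X. \<forall>i\<le>n. X i = x i}"
      by auto
    then show ?thesis
      using m by (simp add: emeasure_distr Q.emeasure_eq_measure quenched_cylinder
          emeasure_pmf_single pmf_history[symmetric] l[symmetric] del: upt_Suc)
  next
    case False
    then have "(\<lambda>X. map X (rev [0..<Suc n])) -` {l} = {}"
      by auto
    moreover have "pmf (history_pmf G n) l = 0"
      using False length_history by (auto simp: pmf_eq_0_set_pmf)
    ultimately show ?thesis
      using m by (simp add: emeasure_distr emeasure_pmf_single del: upt_Suc)
  qed
qed auto

text \<open>The recursion runs on the first step from an arbitrary start, the form used for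
  first-step analysis. \<open>walk_pmf_Suc_right\<close> supplies the last-step form that matches
  \<open>history_pmf\<close>.\<close>

primrec walk_pmf :: "(site \<Rightarrow> site set) \<Rightarrow> nat \<Rightarrow> site \<Rightarrow> site pmf" where
  "walk_pmf G 0 z = return_pmf z"
| "walk_pmf G (Suc n) z = bind_pmf (transition G z) (walk_pmf G n)"

lemma walk_pmf_Suc_right: "walk_pmf G (Suc n) z = bind_pmf (walk_pmf G n z) (transition G)"
proof (induction n arbitrary: z)
  case 0
  have "walk_pmf G 0 = return_pmf" by auto
  then show ?case by (simp add: bind_return_pmf bind_return_pmf')
next
  case (Suc n)
  have "walk_pmf G (Suc (Suc n)) z = bind_pmf (transition G z) (walk_pmf G (Suc n))" by simp
  also have "\<dots> = bind_pmf (transition G z) (\<lambda>y. bind_pmf (walk_pmf G n y) (transition G))"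
    by (intro bind_pmf_cong refl Suc)
  finally show ?case by (simp add: bind_assoc_pmf)
qed

lemma walk_pmf_eq_history: "walk_pmf G n 0 = map_pmf hd (history_pmf G n)"
proof (induction n)
  case (Suc n)
  show ?case
    by (simp only: walk_pmf_Suc_right Suc)
       (simp add: map_bind_pmf bind_map_pmf pmf.map_comp o_def)
qed simp

lemma distr_position:
  "distr (quenched G) (count_space UNIV) (\<lambda>X. X n) = measure_pmf (walk_pmf G n 0)"
proof -
  have m: "(\<lambda>X. map X (rev [0..<Suc n])) \<in> quenched G \<rightarrow>\<^sub>M count_space (UNIV :: site list set)"
    using measurable_history by (simp del: upt_Suc)
  have "distr (quenched G) (count_space UNIV) (\<lambda>X. X n) =
      distr (quenched G) (count_space UNIV) (hd \<circ> (\<lambda>X. map X (rev [0..<Suc n])))"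
    by (simp add: o_def)
  also have "\<dots> = distr (measure_pmf (history_pmf G n)) (count_space UNIV) hd"
    unfolding distr_history[symmetric] using m by (intro distr_distr[symmetric]) auto
  also have "\<dots> = measure_pmf (walk_pmf G n 0)"
    by (simp add: walk_pmf_eq_history map_pmf_rep_eq)
  finally show ?thesis .
qed

lemma AE_quenched_step: 
  assumes "\<And>x. finite (G x)" "\<And>x. G x \<noteq> {}"
  shows "AE X in quenched G. \<forall>n. X (Suc n) - X n \<in> G (X n)"
proof (subst AE_all_countable, rule allI)
  fix n
  have m: "(\<lambda>X. map X (rev [0..<Suc (Suc n)])) \<in> quenched G \<rightarrow>\<^sub>M count_space (UNIV :: site list set)"
    using measurable_history by (simp del: upt_Suc)
  \<comment> \<open>Newest first: index 0 is time \<open>Suc n\<close> and index 1 is time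
    \<open>n\<close>.\<close>
  have "AE l in history_pmf G (Suc n). l ! 0 - l ! 1 \<in> G (l ! 1)"
  proof (rule AE_pmfI)
    fix l assume "l \<in> set_pmf (history_pmf G (Suc n))"
    then obtain k y where k: "k \<in> set_pmf (history_pmf G n)" "y \<in> set_pmf (transition G (hd k))" "l = y # k"
      by auto
    then have "k \<noteq> []" using length_history by fastforce
    with k assms show "l ! 0 - l ! 1 \<in> G (l ! 1)"
      by (auto simp: transition_def hd_conv_nth)
  qed
  then have "AE X in quenched G. map X (rev [0..<Suc (Suc n)]) ! 0 - map X (rev [0..<Suc (Suc n)]) ! 1
      \<in> G (map X (rev [0..<Suc (Suc n)]) ! 1)"
    using m unfolding distr_history[symmetric] by (subst (asm) AE_distr_iff) auto
  then show "AE X in quenched G. X (Suc n) - X n \<in> G (X n)" by simp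
qed

section \<open>Survival in a single row\<close>

text \<open>
  A walk that has not drilled through its row yet is a simple random walk that survives each visit
  to a drilled site with probability 2/3. If \<open>M\<close> is the multiset of sites visited so far, then
  \<open>visit_weight p M\<close> is the survival probability averaged over the environment of the row, and
  \<open>survival p n M x\<close> is its value after \<open>n\<close> more steps of the walk, which is now at \<open>x\<close>.
  In particular \<open>survival p n {#} x\<close> is the probability of spending more than \<open>n\<close> steps in a row.
\<close>

definition visit_weight :: "real \<Rightarrow> int multiset \<Rightarrow> real" where
  "visit_weight p M = (\<Prod>y\<in>set_mset M. 1 - p + p * (2/3) ^ count M y)"

primrec survival :: "real \<Rightarrow> nat \<Rightarrow> int multiset \<Rightarrow> int \<Rightarrow> real" where
  "survival p 0 M x = visit_weight p M"
| "survival p (Suc n) M x =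
    (survival p n (add_mset x M) (x + 1) + survival p n (add_mset x M) (x - 1)) / 2"

lemma visit_factor_bounds:
  assumes "0 \<le> p" "p \<le> 1"
  shows "0 \<le> 1 - p + p * (2/3::real) ^ c" "1 - p + p * (2/3::real) ^ c \<le> 1"
proof -
  have "0 \<le> (2/3::real) ^ c" "(2/3::real) ^ c \<le> 1"
    by (auto intro: power_le_one)
  then have "0 \<le> p * (2/3) ^ c" "p * (2/3) ^ c \<le> p"
    using assms by (auto intro: mult_left_le)
  then show "0 \<le> 1 - p + p * (2/3::real) ^ c" "1 - p + p * (2/3::real) ^ c \<le> 1"
    using assms by linarith+
qed

lemma visit_weight_nonneg: "0 \<le> p \<Longrightarrow> p \<le> 1 \<Longrightarrow> 0 \<le> visit_weight p M"
  unfolding visit_weight_def by (intro prod_nonneg ballI visit_factor_bounds)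

text \<open>A visited site has count at least 1, so its factor is at most 1 - p + 2p/3 = 1 -
  p/3.\<close>

lemma visit_weight_le_power:
  assumes "0 \<le> p" "p \<le> 1"
  shows "visit_weight p M \<le> (1 - p / 3) ^ card (set_mset M)"
proof -
  have "1 - p + p * (2/3) ^ count M y \<le> 1 - p / 3" if y: "y \<in># M" for y
  proof -
    obtain k where "count M y = Suc k"
      using gr0_implies_Suc[of "count M y"] y by auto
    then have "(2/3::real) ^ count M y \<le> 2/3"
      using power_le_one[of "2/3::real" k] by simp
    then have "p * (2/3) ^ count M y \<le> p * (2/3)"
      using assms by (intro mult_left_mono) auto
    then show ?thesis by simp
  qed
  then have "visit_weight p M \<le> (\<Prod>y\<in>set_mset M. 1 - p / 3)"
    unfolding visit_weight_def using visit_factor_bounds[OF assms] by (intro prod_mono) auto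
  then show ?thesis by simp
qed

text \<open>Each factor is 1 - p (1 - (2/3)^c), which decreases in p. All monotonicity in p comes
  from here.\<close>

lemma visit_weight_antimono:
  assumes "0 \<le> p" "p \<le> p'" "p' \<le> 1"
  shows "visit_weight p' M \<le> visit_weight p M"
  unfolding visit_weight_def
proof (intro prod_mono conjI)
  fix y
  show "0 \<le> 1 - p' + p' * (2/3) ^ count M y"
    using assms by (intro visit_factor_bounds) auto
  have "p * (1 - (2/3) ^ count M y) \<le> p' * (1 - (2/3::real) ^ count M y)"
    using assms by (intro mult_right_mono) (auto intro: power_le_one)
  then show "1 - p' + p' * (2/3) ^ count M y \<le> 1 - p + p * (2/3) ^ count M y"
    by (simp add: algebra_simps)
qed

text \<open>An unvisited site has factor 1, so both products can be taken over the enlarged set of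
  sites and compared factor by factor.\<close>

lemma visit_weight_add_le:
  assumes "0 \<le> p" "p \<le> 1"
  shows "visit_weight p (add_mset x M) \<le> visit_weight p M"
proof -
  let ?f = "\<lambda>M y. 1 - p + p * (2/3::real) ^ count M y"
  have le: "?f (add_mset x M) y \<le> ?f M y" for y
    using assms by (auto intro!: mult_left_mono power_decreasing)
  have "visit_weight p (add_mset x M) = (\<Prod>y\<in>insert x (set_mset M). ?f (add_mset x M) y)"
    by (simp add: visit_weight_def)
  also have "\<dots> \<le> (\<Prod>y\<in>insert x (set_mset M). ?f M y)"
    using le visit_factor_bounds[OF assms] by (intro prod_mono) auto
  also have "\<dots> = (\<Prod>y\<in>set_mset M. ?f M y)"
    by (cases "x \<in># M") (simp_all add: insert_absorb not_in_iff)
  finally show ?thesis by (simp add: visit_weight_def)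
qed

lemma survival_nonneg: "0 \<le> p \<Longrightarrow> p \<le> 1 \<Longrightarrow> 0 \<le> survival p n M x"
  by (induction n arbitrary: M x) (auto intro: visit_weight_nonneg)

lemma survival_antimono:
  "0 \<le> p \<Longrightarrow> p \<le> p' \<Longrightarrow> p' \<le> 1 \<Longrightarrow> survival p' n M x \<le> survival p n M x"
  by (induction n arbitrary: M x) (auto intro: visit_weight_antimono intro!: divide_right_mono add_mono)

lemma survival_Suc_le: "0 \<le> p \<Longrightarrow> p \<le> 1 \<Longrightarrow> survival p (Suc n) M x \<le> survival p n M x"
proof (induction n arbitrary: M x)
  case 0
  then show ?case using visit_weight_add_le by simp
next
  case (Suc n)
  then show ?case
    by (subst (1 2) survival.simps(2)) (intro divide_right_mono add_mono, auto simp del: survival.simps)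
qed

lemma visit_weight_translate: "visit_weight p (image_mset (\<lambda>y. y + d) M) = visit_weight p M"
proof -
  have "count (image_mset (\<lambda>y. y + d) M) (y + d) = count M y" for y
    by (simp add: count_image_mset vimage_def Int_insert_left not_in_iff)
  then show ?thesis
    by (simp add: visit_weight_def prod.reindex)
qed

text \<open>Needed because the walk enters a new row at an arbitrary horizontal position.\<close>

lemma survival_translate:
  "survival p n (image_mset (\<lambda>y. y + d) M) (x + d) = survival p n M x"
proof (induction n arbitrary: M x)
  case (Suc n)
  from Suc[of "add_mset x M" "x + 1"] Suc[of "add_mset x M" "x - 1"]
  show ?case by (simp add: algebra_simps)
qed (simp add: visit_weight_translate)

lemma survival_empty_translate: "survival p n {#} x = survival p n {#} 0"
  using survival_translate[of p n x "{#}" 0] by simp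

section \<open>A supersolution on visited intervals and the moments of the row time\<close>

text \<open>
  The expectation of the sum of \<open>\<theta> ^ r\<close> over time, \<open>r\<close> being the size of the visited interval.
  With the walk at distance \<open>y\<close> from the site next to the left end of the interval,
  \<open>y * (r + 1 - y)\<close> is the expected time until the interval grows; the linear term
  accounts for all larger intervals.
\<close>

definition range_potential :: "real \<Rightarrow> nat \<Rightarrow> nat \<Rightarrow> real" where
  "range_potential \<theta> r y = \<theta> ^ r * (real y * (real r + 1 - real y)
     + \<theta> / (1 - \<theta>) * real r + (1 + \<theta> / (1 - \<theta>) * \<theta>) / (1 - \<theta>))"

text \<open>Inside the interval only the quadratic term varies with \<open>y\<close>. Its second
  difference is -2, so one averaging step loses exactly \<open>\<theta> ^ r\<close>.\<close>

lemma range_potential_interior: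
  "range_potential \<theta> r (Suc y) =
    \<theta> ^ r + (range_potential \<theta> r (Suc (Suc y)) + range_potential \<theta> r y) / 2"
proof -
  define C where "C = \<theta> / (1 - \<theta>) * real r + (1 + \<theta> / (1 - \<theta>) * \<theta>) / (1 - \<theta>)"
  have pot: "range_potential \<theta> r z = \<theta> ^ r * (real z * (real r + 1 - real z) + C)" for z
    by (simp add: range_potential_def C_def)
  show ?thesis
    unfolding pot by (simp add: field_simps)
qed

text \<open>Reflection of the interval; it reduces the right end to the left end.\<close>

lemma range_potential_sym: "y \<le> Suc r \<Longrightarrow> range_potential \<theta> r (Suc r - y) = range_potential \<theta> r y"
  by (simp add: range_potential_def of_nat_diff algebra_simps)

text \<open>The site left of the interval joins it, so the neighbours get coordinates 2 and 0
  relative to an interval of length \<open>Suc r\<close>. The constants \<open>A\<close> and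
  \<open>B\<close> in the potential solve the resulting linear equations in
  \<open>r\<close>.\<close>

lemma range_potential_boundary:
  assumes "0 < \<theta>" "\<theta> < 1"
  shows "\<theta> ^ r + (range_potential \<theta> (Suc r) 2 + range_potential \<theta> (Suc r) 0) / 2
    \<le> range_potential \<theta> r 0"
proof -
  define A B where "A = \<theta> / (1 - \<theta>)" and "B = (1 + A * \<theta>) / (1 - \<theta>)"
  have "A * (1 - \<theta>) = \<theta>" "B * (1 - \<theta>) = 1 + A * \<theta>"
    using assms by (simp_all add: A_def B_def)
  then have A: "A = \<theta> + A * \<theta>" and B: "B = 1 + A * \<theta> + B * \<theta>"
    by (simp_all add: algebra_simps)
  have "1 + (r + A * (r + 1) + B) * \<theta> = (\<theta> + A * \<theta>) * r + (1 + A * \<theta> + B * \<theta>)"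
    by (simp add: algebra_simps)
  then have "1 + (r + A * (r + 1) + B) * \<theta> = A * r + B"
    by (simp only: A[symmetric] B[symmetric])
  then have "\<theta> ^ r * (1 + (r + A * (r + 1) + B) * \<theta>) = \<theta> ^ r * (A * r + B)"
    by simp
  then show ?thesis
    unfolding range_potential_def A_def[symmetric] B_def[symmetric]
    by (simp add: algebra_simps add_divide_distrib)
qed

lemma range_potential_nonneg:
  assumes "0 < \<theta>" "\<theta> < 1" "y \<le> Suc r"
  shows "0 \<le> range_potential \<theta> r y"
  unfolding range_potential_def using assms
  by (intro mult_nonneg_nonneg add_nonneg_nonneg divide_nonneg_nonneg) auto

text \<open>A comparison principle: \<open>S\<close> starts below 0 and gains at most
  \<open>K * \<theta> ^ r\<close> per step beyond the average over the neighbours, whereas the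
  potential pays for exactly this gain. Coordinates 0 and \<open>Suc r\<close> are the sites just
  outside the visited interval.\<close>

lemma supersolution_bound:
  fixes S :: "nat \<Rightarrow> int multiset \<Rightarrow> int \<Rightarrow> real"
  assumes \<theta>: "0 < \<theta>" "\<theta> < 1" and K: "0 \<le> K"
    and S0: "\<And>M x. S 0 M x \<le> 0"
    and step: "\<And>N M a r y. set_mset M = {a..<a + int r} \<Longrightarrow> y \<le> Suc r \<Longrightarrow>
      S (Suc N) M (a - 1 + int y) \<le> K * \<theta> ^ r +
        (S N (add_mset (a - 1 + int y) M) (a - 1 + int y + 1) +
         S N (add_mset (a - 1 + int y) M) (a - 1 + int y - 1)) / 2"
  shows "set_mset M = {a..<a + int r} \<Longrightarrow> y \<le> Suc r \<Longrightarrow>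
    S N M (a - 1 + int y) \<le> K * range_potential \<theta> r y"
proof (induction N arbitrary: M a r y)
  case 0
  then show ?case using K range_potential_nonneg[OF \<theta>] by (intro order.trans[OF S0]) auto
next
  case (Suc N)
  let ?x = "a - 1 + int y"
  let ?M = "add_mset ?x M"
  note st = step[OF Suc.prems, of N]
  \<comment> \<open>The walk is just left of the interval, just right of it, or inside. In the first
    two cases the interval grows by one site.\<close>
  consider "y = 0" | "y = Suc r" | z where "y = Suc z" "z < r"
    using Suc.prems(2) by (cases y) (auto simp: less_Suc_eq_le le_less)
  then show ?case
  proof cases
    case 1
    have x: "?x = a - 1" using 1 by simp
    have M: "set_mset ?M = {a - 1..<(a - 1) + int (Suc r)}"
      unfolding x set_mset_add_mset_insert Suc.prems(1) by auto
    have "S N ?M (?x + 1) \<le> K * range_potential \<theta> (Suc r) 2"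
      using Suc.IH[OF M, of 2] 1 by (simp add: algebra_simps)
    moreover have "S N ?M (?x - 1) \<le> K * range_potential \<theta> (Suc r) 0"
      using Suc.IH[OF M, of 0] 1 by (simp add: algebra_simps)
    ultimately have "S (Suc N) M ?x \<le>
        K * (\<theta> ^ r + (range_potential \<theta> (Suc r) 2 + range_potential \<theta> (Suc r) 0) / 2)"
      using st by (simp add: algebra_simps add_divide_distrib)
    also have "\<dots> \<le> K * range_potential \<theta> r 0"
      using K by (intro mult_left_mono range_potential_boundary[OF \<theta>])
    finally show ?thesis using 1 by simp
  next
    case 2
    have x: "?x = a + int r" using 2 by simp
    have M: "set_mset ?M = {a..<a + int (Suc r)}"
      unfolding x set_mset_add_mset_insert Suc.prems(1) by auto
    have "S N ?M (?x + 1) \<le> K * range_potential \<theta> (Suc r) (Suc (Suc r))"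
      using Suc.IH[OF M, of "Suc (Suc r)"] x by (simp add: algebra_simps)
    also have "range_potential \<theta> (Suc r) (Suc (Suc r)) = range_potential \<theta> (Suc r) 0"
      using range_potential_sym[of 0 "Suc r" \<theta>] by simp
    finally have 3: "S N ?M (?x + 1) \<le> K * range_potential \<theta> (Suc r) 0" .
    have "S N ?M (?x - 1) \<le> K * range_potential \<theta> (Suc r) r"
      using Suc.IH[OF M, of r] x by (simp add: algebra_simps)
    also have "range_potential \<theta> (Suc r) r = range_potential \<theta> (Suc r) 2"
      using range_potential_sym[of 2 "Suc r" \<theta>] by simp
    finally have "S (Suc N) M ?x \<le>
        K * (\<theta> ^ r + (range_potential \<theta> (Suc r) 2 + range_potential \<theta> (Suc r) 0) / 2)"
      using st 3 by (simp add: algebra_simps add_divide_distrib)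
    also have "\<dots> \<le> K * range_potential \<theta> r 0"
      using K by (intro mult_left_mono range_potential_boundary[OF \<theta>])
    also have "range_potential \<theta> r 0 = range_potential \<theta> r y"
      using range_potential_sym[of 0 r \<theta>] 2 by simp
    finally show ?thesis .
  next
    case 3
    have x: "?x = a + int z" using 3 by simp
    have "?x \<in># M" unfolding x Suc.prems(1) using 3 by simp
    then have M: "set_mset ?M = {a..<a + int r}"
      using Suc.prems(1) by (simp add: insert_absorb)
    have "S N ?M (?x + 1) \<le> K * range_potential \<theta> r (Suc (Suc z))"
      using Suc.IH[OF M, of "Suc (Suc z)"] x 3(2) by (simp add: algebra_simps)
    moreover have "S N ?M (?x - 1) \<le> K * range_potential \<theta> r z"
      using Suc.IH[OF M, of z] x 3(2) by (simp add: algebra_simps)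
    ultimately have "S (Suc N) M ?x \<le> K * (\<theta> ^ r +
        (range_potential \<theta> r (Suc (Suc z)) + range_potential \<theta> r z) / 2)"
      using st by (simp add: algebra_simps add_divide_distrib)
    then show ?thesis
      unfolding 3(1) range_potential_interior[of \<theta> r z] .
  qed
qed

text \<open>One factor \<open>\<theta> ^ r\<close> out of \<open>(\<theta>\<^sup>2) ^ r\<close>
  absorbs the polynomial in \<open>r\<close>. The first-moment bound thereby becomes a geometric
  source to which \<open>supersolution_bound\<close> applies again.\<close>

lemma range_potential_le_power:
  assumes \<theta>: "0 < \<theta>" "\<theta> < 1"
  obtains K where "0 \<le> K" "\<And>r y. y \<le> Suc r \<Longrightarrow> range_potential (\<theta>\<^sup>2) r y \<le> K * \<theta> ^ r"
proof -
  define A B where "A = \<theta>\<^sup>2 / (1 - \<theta>\<^sup>2)" and "B = (1 + A * \<theta>\<^sup>2) / (1 - \<theta>\<^sup>2)"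
  have "(\<lambda>r::nat. \<theta> ^ r * ((real r + 1) * (real r + 1) + A * real r + B)) \<longlonglongrightarrow> 0"
    using \<theta> by real_asymp
  then have "Bseq (\<lambda>r::nat. \<theta> ^ r * ((real r + 1) * (real r + 1) + A * real r + B))"
    by (intro convergent_imp_Bseq convergentI)
  then obtain K where K: "0 < K"
    "\<And>r::nat. norm (\<theta> ^ r * ((real r + 1) * (real r + 1) + A * real r + B)) \<le> K"
    by (auto elim!: BseqE)
  show thesis
  proof (rule that[of K])
    fix r y :: nat assume y: "y \<le> Suc r"
    have "real y * (real r + 1 - real y) \<le> (real r + 1) * (real r + 1)"
      using y by (intro mult_mono) auto
    then have "range_potential (\<theta>\<^sup>2) r y \<le>
        (\<theta>\<^sup>2) ^ r * ((real r + 1) * (real r + 1) + A * real r + B)"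
      unfolding range_potential_def A_def[symmetric] B_def[symmetric]
      by (intro mult_left_mono) auto
    also have "\<dots> = \<theta> ^ r * (\<theta> ^ r * ((real r + 1) * (real r + 1) + A * real r + B))"
      by (simp add: power2_eq_square power_mult_distrib)
    also have "\<dots> \<le> \<theta> ^ r * K"
      using K(2)[of r] \<theta> by (intro mult_left_mono) auto
    finally show "range_potential (\<theta>\<^sup>2) r y \<le> K * \<theta> ^ r" by (simp add: mult.commute)
  qed (use K in auto)
qed

text \<open>Splitting off the term n = 0 of the partial sum leaves the average of the partial sums
  at the two neighbours; the split-off term is a \<open>visit_weight\<close>, at most (1 -
  p/3)^r.\<close>

lemma sum_survival_le:
  assumes p: "0 < p" "p < 1" and M: "set_mset M = {a..<a + int r}" "y \<le> Suc r"
  shows "(\<Sum>n<N. survival p n M (a - 1 + int y)) \<le> range_potential (1 - p / 3) r y"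
proof -
  let ?S = "\<lambda>N M x. \<Sum>n<N. survival p n M x"
  have "?S N M (a - 1 + int y) \<le> 1 * range_potential (1 - p / 3) r y"
  proof (rule supersolution_bound[where S = ?S, OF _ _ _ _ _ M])
    fix N M a y and r :: nat assume "set_mset M = {a..<a + int r}"
    then have "visit_weight p M \<le> (1 - p / 3) ^ r"
      using visit_weight_le_power[of p M] p by simp
    then show "?S (Suc N) M (a - 1 + int y) \<le> 1 * (1 - p / 3) ^ r +
        (?S N (add_mset (a - 1 + int y) M) (a - 1 + int y + 1) +
         ?S N (add_mset (a - 1 + int y) M) (a - 1 + int y - 1)) / 2"
      by (subst sum.lessThan_Suc_shift) (simp add: sum_divide_distrib sum.distrib add_divide_distrib)
  qed (use p in auto)
  then show ?thesis by simp
qed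

text \<open>This amounts to a finite second moment of the row time. The weight \<open>Suc n\<close>
  is 1 + n: the part with weight 1 is the source, bounded by \<open>sum_survival_le\<close>, and the
  part with weight n shifts to the weighted sums at the neighbours. The square root in
  \<open>\<theta>\<close> pays for the polynomial factor.\<close>

lemma summable_Suc_survival:
  assumes p: "0 < p" "p < 1"
  shows "summable (\<lambda>n. real (Suc n) * survival p n {#} 0)"
proof -
  let ?S = "\<lambda>N M x. \<Sum>n<N. survival p n M x"
  let ?T = "\<lambda>N M x. \<Sum>n<N. real (Suc n) * survival p n M x"
  define \<theta> where "\<theta> = sqrt (1 - p / 3)"
  have \<theta>: "0 < \<theta>" "\<theta> < 1" and \<theta>2: "\<theta>\<^sup>2 = 1 - p / 3"
    using p by (auto simp: \<theta>_def)
  obtain K where K: "0 \<le> K" "\<And>r y. y \<le> Suc r \<Longrightarrow> range_potential (\<theta>\<^sup>2) r y \<le> K * \<theta> ^ r"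
    by (rule range_potential_le_power[OF \<theta>], rule that)
  \<comment> \<open>The empty history is the empty interval with a = 1 and r = 0; y = 0 then puts
    the walk at the origin.\<close>
  have "?T N {#} (1 - 1 + int 0) \<le> K * range_potential \<theta> 0 0" for N
  proof (rule supersolution_bound[where S = ?T, OF \<theta> K(1)])
    fix N M a r y
    assume M: "set_mset M = {a..<a + int r}" "y \<le> Suc r"
    let ?x = "a - 1 + int y"
    have "?T (Suc N) M ?x = ?S (Suc N) M ?x + (\<Sum>n<Suc N. real n * survival p n M ?x)"
      by (simp add: sum.distrib algebra_simps)
    also have "(\<Sum>n<Suc N. real n * survival p n M ?x) =
        (?T N (add_mset ?x M) (?x + 1) + ?T N (add_mset ?x M) (?x - 1)) / 2"
      by (subst sum.lessThan_Suc_shift)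
         (simp add: sum_divide_distrib sum.distrib add_divide_distrib algebra_simps)
    also have "?S (Suc N) M ?x \<le> K * \<theta> ^ r"
      using order.trans[OF sum_survival_le[OF p M] K(2)[OF M(2), unfolded \<theta>2]] .
    finally show "?T (Suc N) M ?x \<le> K * \<theta> ^ r +
        (?T N (add_mset ?x M) (?x + 1) + ?T N (add_mset ?x M) (?x - 1)) / 2"
      by simp
  qed auto
  then have "?T N {#} 0 \<le> K * range_potential \<theta> 0 0" for N by simp
  then show ?thesis
    using survival_nonneg p by (intro summableI_nonneg_bounded) auto
qed

lemma survival_1: "survival p 1 {#} 0 = 1 - p / 3"
  by (simp add: visit_weight_def)

section \<open>Independence of the rows\<close>

lemma prob_space_environment: "prob_space (environment \<mu>)"
  unfolding environment_def by (intro prob_space_PiM measure_pmf.prob_space_axioms)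

lemma space_environment [simp]: "space (environment \<mu>) = UNIV"
  by (simp add: environment_def space_PiM)

lemma measurable_environment_component [measurable]:
  "(\<lambda>G. f (G z) :: real) \<in> borel_measurable (environment \<mu>)"
proof -
  have "(\<lambda>G. G z) \<in> environment \<mu> \<rightarrow>\<^sub>M measure_pmf \<mu>"
    unfolding environment_def by (intro measurable_component_singleton) auto
  then show ?thesis
    by (rule measurable_compose) simp
qed

text \<open>Independence of a single site in operational form: redrawing its set does not change the
  law of the environment.\<close>

lemma environment_resample:
  shows "(\<lambda>(S, G). G(z := S)) \<in> measure_pmf \<mu> \<Otimes>\<^sub>M environment \<mu> \<rightarrow>\<^sub>M environment \<mu>"
    and "distr (measure_pmf \<mu> \<Otimes>\<^sub>M environment \<mu>) (environment \<mu>) (\<lambda>(S, G). G(z := S)) = environment \<mu>"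
proof -
  show "(\<lambda>(S, G). G(z := S)) \<in> measure_pmf \<mu> \<Otimes>\<^sub>M environment \<mu> \<rightarrow>\<^sub>M environment \<mu>"
    unfolding environment_def split_beta
    by (rule measurable_fun_upd[where J = UNIV]) auto
  show "distr (measure_pmf \<mu> \<Otimes>\<^sub>M environment \<mu>) (environment \<mu>) (\<lambda>(S, G). G(z := S)) = environment \<mu>"
    using distr_pair_PiM_eq_PiM[of UNIV "\<lambda>_. measure_pmf \<mu>" z]
    by (simp add: environment_def measure_pmf.prob_space_axioms)
qed

text \<open>After redrawing site \<open>z\<close>, \<open>g\<close> sees only the fresh set and
  \<open>F\<close> only the rest, so Fubini factors the integral.\<close>

lemma integral_environment_coordinate:
  fixes g :: "site set \<Rightarrow> real" and F :: "(site \<Rightarrow> site set) \<Rightarrow> real"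
  assumes [measurable]: "F \<in> borel_measurable (environment \<mu>)"
    and g: "\<And>S. \<bar>g S\<bar> \<le> B" and F: "\<And>G. \<bar>F G\<bar> \<le> C"
    and indep: "\<And>G S. F (G(z := S)) = F G"
  shows "(\<integral>G. g (G z) * F G \<partial>environment \<mu>) = (\<integral>S. g S \<partial>measure_pmf \<mu>) * (\<integral>G. F G \<partial>environment \<mu>)"
proof -
  interpret E: prob_space "environment \<mu>" by (rule prob_space_environment)
  interpret P: pair_prob_space "measure_pmf \<mu>" "environment \<mu>" ..
  have [measurable]: "g \<in> borel_measurable (measure_pmf \<mu>)" by simp
  have bound: "\<bar>g S * F G\<bar> \<le> B * C" for S G
    using mult_mono[OF g F] g[of S] by (simp add: abs_mult)
  have int: "integrable (measure_pmf \<mu> \<Otimes>\<^sub>M environment \<mu>) (\<lambda>(S, G). g S * F G)"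
  proof (rule P.integrable_const_bound[of _ "B * C"])
    show "(\<lambda>(S, G). g S * F G) \<in> borel_measurable (measure_pmf \<mu> \<Otimes>\<^sub>M environment \<mu>)"
      unfolding split_beta by measurable
  qed (use bound in auto)
  have "(\<integral>G. g (G z) * F G \<partial>environment \<mu>) =
      (\<integral>G. g (G z) * F G \<partial>distr (measure_pmf \<mu> \<Otimes>\<^sub>M environment \<mu>) (environment \<mu>) (\<lambda>(S, G). G(z := S)))"
    by (simp only: environment_resample)
  also have "\<dots> = (\<integral>(S, G). g S * F G \<partial>(measure_pmf \<mu> \<Otimes>\<^sub>M environment \<mu>))"
    by (subst integral_distr[OF environment_resample(1)]) (auto simp: case_prod_unfold indep)
  also have "\<dots> = (\<integral>S. \<integral>G. g S * F G \<partial>environment \<mu> \<partial>measure_pmf \<mu>)"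
    using P.integral_fst'[OF int] by (simp add: split_beta)
  finally show ?thesis by simp
qed

section \<open>Averaging over the environment of one row\<close>

definition keep :: "(site \<Rightarrow> site set) \<Rightarrow> site \<Rightarrow> real" where
  "keep G z = (if - e2 \<in> G z then 2 / 3 else 1)"

lemma measurable_keep [measurable]: "(\<lambda>G. keep G z) \<in> borel_measurable (environment \<mu>)"
  unfolding keep_def by (rule measurable_environment_component)

lemma keep_bounds: "0 \<le> keep G z" "keep G z \<le> 1"
  by (auto simp: keep_def)

lemma keep_upd: "w \<noteq> z \<Longrightarrow> keep (G(w := S)) z = keep G z"
  by (simp add: keep_def)

lemma integral_keep_power:
  assumes "0 \<le> p" "p \<le> 1"
  shows "(\<integral>S. (if - e2 \<in> S then 2 / 3 else 1) ^ c \<partial>measure_pmf (step_set_law p)) = 1 - p + p * (2/3::real) ^ c"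
  using assms by (simp add: step_set_law_def e1_def e2_def uminus_prod_def algebra_simps)

text \<open>The sites of the row are integrated out one at a time; neither the remaining factors nor
  \<open>F\<close> depend on the site being removed.\<close>

lemma integral_row_prod:
  fixes F :: "(site \<Rightarrow> site set) \<Rightarrow> real"
  assumes p: "0 \<le> p" "p \<le> 1"
    and F [measurable]: "F \<in> borel_measurable (environment (step_set_law p))"
    and C: "\<And>G. \<bar>F G\<bar> \<le> C"
    and indep: "\<And>G S y. F (G((y, r) := S)) = F G"
    and "finite A"
  shows "(\<integral>G. (\<Prod>y\<in>A. keep G (y, r) ^ m y) * F G \<partial>environment (step_set_law p)) =
    (\<Prod>y\<in>A. 1 - p + p * (2/3) ^ m y) * (\<integral>G. F G \<partial>environment (step_set_law p))"
  using \<open>finite A\<close>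
proof (induction A rule: finite_induct)
  case (insert a A)
  let ?g = "\<lambda>S. (if - e2 \<in> S then 2 / 3 else 1 :: real) ^ m a"
  let ?F = "\<lambda>G. (\<Prod>y\<in>A. keep G (y, r) ^ m y) * F G"
  have "(\<integral>G. ?g (G (a, r)) * ?F G \<partial>environment (step_set_law p)) =
      (\<integral>S. ?g S \<partial>measure_pmf (step_set_law p)) * (\<integral>G. ?F G \<partial>environment (step_set_law p))"
  proof (rule integral_environment_coordinate[where B = 1 and C = "1 * C"])
    show "?F \<in> borel_measurable (environment (step_set_law p))" by measurable
    show "\<bar>?g S\<bar> \<le> 1" for S by (auto intro: power_le_one)
    show "\<bar>?F G\<bar> \<le> 1 * C" for G
    proof -
      have "\<bar>\<Prod>y\<in>A. keep G (y, r) ^ m y\<bar> \<le> 1"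
        using keep_bounds by (simp add: abs_prod prod_le_1 power_le_one)
      then show ?thesis
        unfolding abs_mult using C by (intro mult_mono) auto
    qed
    show "?F (G((a, r) := S)) = ?F G" for G S
    proof -
      have "keep (G((a, r) := S)) (y, r) = keep G (y, r)" if "y \<in> A" for y
        using that insert by (intro keep_upd) auto
      then show ?thesis by (simp add: indep)
    qed
  qed
  then show ?case
    using insert integral_keep_power[OF p] by (simp add: keep_def mult.assoc)
qed simp

lemma integral_visits:
  fixes F :: "(site \<Rightarrow> site set) \<Rightarrow> real"
  assumes "0 \<le> p" "p \<le> 1"
    and "F \<in> borel_measurable (environment (step_set_law p))"
    and "\<And>G. \<bar>F G\<bar> \<le> C"
    and "\<And>G S y. F (G((y, r) := S)) = F G"
  shows "(\<integral>G. (\<Prod>y\<in>#M. keep G (y, r)) * F G \<partial>environment (step_set_law p)) =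
    visit_weight p M * (\<integral>G. F G \<partial>environment (step_set_law p))"
  using integral_row_prod[OF assms, of "set_mset M" "count M"]
  by (simp add: visit_weight_def image_prod_mset_multiplicity)

text \<open>
  The quenched probability of having descended fewer than \<open>k\<close> rows after \<open>n\<close> steps from \<open>z\<close>
  (see \<open>measure_walk_eq_above_prob\<close>), with \<open>keep G z\<close> the probability of not descending from \<open>z\<close>.
\<close>

fun above_prob :: "(site \<Rightarrow> site set) \<Rightarrow> nat \<Rightarrow> nat \<Rightarrow> site \<Rightarrow> real" where
  "above_prob G 0 n z = 0"
| "above_prob G (Suc k) 0 z = 1"
| "above_prob G (Suc k) (Suc n) z =
    keep G z / 2 * (above_prob G (Suc k) n (z + e1) + above_prob G (Suc k) n (z - e1))
    + (1 - keep G z) * above_prob G k n (z - e2)"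

lemma above_prob_bounds: "0 \<le> above_prob G k n z \<and> above_prob G k n z \<le> 1"
proof (induction G k n z rule: above_prob.induct)
  case (3 G k n z)
  let ?a = "above_prob G (Suc k) n (z + e1) + above_prob G (Suc k) n (z - e1)"
  let ?b = "above_prob G k n (z - e2)"
  have "keep G z / 2 * ?a \<le> keep G z / 2 * 2" "(1 - keep G z) * ?b \<le> (1 - keep G z) * 1"
    using 3 keep_bounds[of G z] by (intro mult_left_mono; auto)+
  then show ?case
    using 3 keep_bounds[of G z] by (auto intro!: add_nonneg_nonneg mult_nonneg_nonneg)
qed auto

lemma measurable_above_prob [measurable]:
  "(\<lambda>G. above_prob G k n z) \<in> borel_measurable (environment \<mu>)"
proof (induction n arbitrary: k z)
  case 0
  show ?case by (cases k) auto
next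
  case (Suc n)
  note [measurable] = Suc
  show ?case by (cases k) auto
qed

text \<open>The recursion moves sideways or down, so from \<open>z\<close> it never reads a site in
  a higher row.\<close>

lemma above_prob_upd: "snd z < snd w \<Longrightarrow> above_prob (G(w := S)) k n z = above_prob G k n z"
proof (induction n arbitrary: k z)
  case 0
  show ?case by (cases k) auto
next
  case (Suc n)
  have "keep (G(w := S)) z = keep G z"
    using Suc.prems by (intro keep_upd) auto
  moreover have "snd (z + e1) < snd w" "snd (z - e1) < snd w" "snd (z - e2) < snd w"
    using Suc.prems by (auto simp: e1_def e2_def)
  ultimately show ?case
    using Suc.IH by (cases k) (simp_all del: fun_upd_apply)
qed

text \<open>
  The tail at \<open>n\<close> of a sum of \<open>k\<close> independent copies of the time spent in a row.
\<close>

primrec renewal_tail :: "real \<Rightarrow> nat \<Rightarrow> nat \<Rightarrow> real" where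
  "renewal_tail p 0 n = 0"
| "renewal_tail p (Suc k) n = survival p n {#} 0 +
    (\<Sum>t<n. (survival p t {#} 0 - survival p (Suc t) {#} 0) * renewal_tail p k (n - Suc t))"

text \<open>
  A walk that descends never returns, so the environment of the visited row is independent of
  everything that happens afterwards.
\<close>

lemma integral_visits_above_prob:
  assumes p: "0 \<le> p" "p \<le> 1"
    and IH: "\<And>n z. (\<integral>G. above_prob G k n z \<partial>environment (step_set_law p)) = renewal_tail p k n"
  shows "(\<integral>G. (\<Prod>y\<in>#M. keep G (y, r)) * above_prob G (Suc k) n (x, r) \<partial>environment (step_set_law p)) =
    survival p n M x +
    (\<Sum>t<n. (survival p t M x - survival p (Suc t) M x) * renewal_tail p k (n - Suc t))"
proof (induction n arbitrary: M x)
  case 0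
  interpret E: prob_space "environment (step_set_law p)" by (rule prob_space_environment)
  show ?case
    using integral_visits[OF p, of "\<lambda>_. 1" 1 r M] E.prob_space by simp
next
  case (Suc n)
  let ?E = "environment (step_set_law p)"
  let ?V = "\<lambda>M G. \<Prod>y\<in>#M. keep G (y, r)"
  let ?M = "add_mset x M"
  let ?A = "\<lambda>G. ?V ?M G * above_prob G (Suc k) n (x + 1, r)"
  let ?B = "\<lambda>G. ?V ?M G * above_prob G (Suc k) n (x - 1, r)"
  let ?C = "\<lambda>M G. ?V M G * above_prob G k n (x, r - 1)"
  interpret E: prob_space ?E by (rule prob_space_environment)
  have [measurable]: "?V M \<in> borel_measurable ?E" for M
    by (induction M) auto
  have V: "0 \<le> ?V M G \<and> ?V M G \<le> 1" for M G
    by (induction M) (auto intro!: mult_nonneg_nonneg mult_le_one keep_bounds)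
  have int: "integrable ?E (\<lambda>G. ?V M G * above_prob G j n z)" for M j z
  proof (rule E.integrable_const_bound[of _ 1])
    have "\<bar>?V M G * above_prob G j n z\<bar> \<le> 1" for G
      using V[of G M] above_prob_bounds[of G j n z] by (simp add: abs_mult mult_le_one)
    then show "AE G in ?E. norm (?V M G * above_prob G j n z) \<le> 1" by simp
  qed measurable
  \<comment> \<open>After a descent the walk is in row \<open>r - 1\<close> and
    \<open>above_prob\<close> no longer depends on row \<open>r\<close>, so the weight of that row
    factors out.\<close>
  have C: "(\<integral>G. ?C M G \<partial>?E) = visit_weight p M * renewal_tail p k n" for M
    unfolding IH[of n "(x, r - 1)", symmetric]
    using above_prob_bounds by (intro integral_visits[OF p, where C = 1] above_prob_upd) auto
  have linear: "(\<integral>G. (a G + b G) / 2 + (c G - d G) \<partial>?E) =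
      ((\<integral>G. a G \<partial>?E) + (\<integral>G. b G \<partial>?E)) / 2 + ((\<integral>G. c G \<partial>?E) - (\<integral>G. d G \<partial>?E))"
    if "integrable ?E a" "integrable ?E b" "integrable ?E c" "integrable ?E d"
    for a b c d :: "(site \<Rightarrow> site set) \<Rightarrow> real"
    using that by simp
  \<comment> \<open>Multiplying by \<open>keep\<close> records one more visit to \<open>x\<close>;
    multiplying by \<open>1 - keep\<close> gives the weight without that visit minus the weight with
    it.\<close>
  have "?V M G * above_prob G (Suc k) (Suc n) (x, r) = (?A G + ?B G) / 2 + (?C M G - ?C ?M G)" for G
    by (simp add: e1_def e2_def algebra_simps add_divide_distrib)
  then have "(\<integral>G. ?V M G * above_prob G (Suc k) (Suc n) (x, r) \<partial>?E) =
      ((\<integral>G. ?A G \<partial>?E) + (\<integral>G. ?B G \<partial>?E)) / 2 + ((\<integral>G. ?C M G \<partial>?E) - (\<integral>G. ?C ?M G \<partial>?E))"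
    by (simp only: linear[OF int int int int])
  also have "\<dots> = survival p (Suc n) M x + ((visit_weight p M - visit_weight p ?M) * renewal_tail p k n +
      (\<Sum>t<n. (survival p (Suc t) M x - survival p (Suc (Suc t)) M x) * renewal_tail p k (n - Suc t)))"
    unfolding Suc C
    by (simp add: sum_divide_distrib sum.distrib[symmetric] algebra_simps add_divide_distrib
          diff_divide_distrib sum_subtractf)
  also have "visit_weight p M - visit_weight p ?M = survival p 0 M x - survival p (Suc 0) M x"
    by simp
  \<comment> \<open>An immediate descent supplies the term t = 0; the later descents are the shifted
    sum.\<close>
  also have "(survival p 0 M x - survival p (Suc 0) M x) * renewal_tail p k n +
      (\<Sum>t<n. (survival p (Suc t) M x - survival p (Suc (Suc t)) M x) * renewal_tail p k (n - Suc t)) =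
      (\<Sum>t<Suc n. (survival p t M x - survival p (Suc t) M x) * renewal_tail p k (Suc n - Suc t))"
    by (subst sum.lessThan_Suc_shift) simp
  finally show ?case .
qed

lemma integral_above_prob:
  assumes "0 \<le> p" "p \<le> 1"
  shows "(\<integral>G. above_prob G k n z \<partial>environment (step_set_law p)) = renewal_tail p k n"
proof (induction k arbitrary: n z)
  case (Suc k)
  obtain x r where z: "z = (x, r)" by fastforce
  show ?case
    using integral_visits_above_prob[OF assms Suc, where M = "{#}" and r = r and n = n and x = x]
    by (simp add: z survival_empty_translate[of p _ x] del: survival.simps)
qed simp

section \<open>Sums of independent row times\<close>

text \<open>The increments of \<open>h\<close> telescope to \<open>h 0\<close> minus the limit,
  which is 1. The row time is thus obtained as an abstract law, without building exit times on path
  space.\<close>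

lemma tail_pmf_exists:
  fixes h :: "nat \<Rightarrow> real"
  assumes h0: "h 0 = 1" and dec: "\<And>n. h (Suc n) \<le> h n" and lim: "h \<longlonglongrightarrow> 0"
  obtains \<rho> :: "nat pmf" where "pmf \<rho> 0 = 0" "\<And>t. pmf \<rho> (Suc t) = h t - h (Suc t)"
    "\<And>n. measure \<rho> {n<..} = h n"
proof -
  define f where "f t = (case t of 0 \<Rightarrow> 0 | Suc s \<Rightarrow> h s - h (Suc s))" for t
  have f_nonneg: "0 \<le> f t" for t
    using dec by (auto simp: f_def split: nat.split)
  have "(\<lambda>s. f (Suc s)) sums (1 - 0)"
    using telescope_sums'[OF lim] by (simp add: f_def h0)
  then have "f sums 1"
    by (subst (asm) sums_Suc_iff) (simp add: f_def)
  then have "(\<integral>\<^sup>+t. ennreal (f t) \<partial>count_space UNIV) = 1"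
    using f_nonneg by (simp add: nn_integral_count_space_nat suminf_ennreal_eq sums_iff)
  then have pmf: "pmf (embed_pmf f) t = f t" for t
    using f_nonneg by (intro pmf_embed_pmf)
  show thesis
  proof (rule that[of "embed_pmf f"])
    fix n
    have "sum f {..n} = 1 - h n"
      by (induction n) (auto simp: f_def h0)
    then have "measure (embed_pmf f) {..n} = 1 - h n"
      by (simp add: measure_measure_pmf_finite pmf)
    moreover have "{n<..} = UNIV - {..n}" by auto
    ultimately show "measure (embed_pmf f) {n<..} = h n"
      using measure_pmf.prob_compl[of "{..n}" "embed_pmf f"] by simp
  qed (simp_all add: pmf f_def)
qed

text \<open>The sum over s < t is a sum over all s against the indicator of t > s, and sum and
  integral are exchanged. Weights 1 and 2s + 1 yield the first and second moments.\<close>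

lemma nn_integral_nat_pmf_tail:
  fixes \<rho> :: "nat pmf" and w :: "nat \<Rightarrow> real"
  assumes w: "\<And>s. 0 \<le> w s" and sum: "summable (\<lambda>s. w s * measure \<rho> {s<..})"
  shows "(\<integral>\<^sup>+t. ennreal (\<Sum>s<t. w s) \<partial>\<rho>) = ennreal (\<Sum>s. w s * measure \<rho> {s<..})"
proof -
  have "ennreal (\<Sum>s<t. w s) = (\<Sum>s. ennreal (w s) * indicator {s<..} t)" for t
    using w by (subst suminf_finite[of "{..<t}"]) (auto simp: sum_ennreal indicator_def intro!: sum.cong)
  then have "(\<integral>\<^sup>+t. ennreal (\<Sum>s<t. w s) \<partial>\<rho>) = (\<integral>\<^sup>+t. (\<Sum>s. ennreal (w s) * indicator {s<..} t) \<partial>\<rho>)"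
    by simp
  also have "\<dots> = (\<Sum>s. \<integral>\<^sup>+t. ennreal (w s) * indicator {s<..} t \<partial>\<rho>)"
    by (intro nn_integral_suminf) auto
  also have "\<dots> = (\<Sum>s. ennreal (w s * measure \<rho> {s<..}))"
    using w by (simp add: nn_integral_cmult_indicator measure_pmf.emeasure_eq_measure ennreal_mult)
  also have "\<dots> = ennreal (\<Sum>s. w s * measure \<rho> {s<..})"
    using w sum by (intro suminf_ennreal2) auto
  finally show ?thesis .
qed

lemma nat_pmf_moments:
  fixes \<rho> :: "nat pmf" and h :: "nat \<Rightarrow> real"
  assumes tail: "\<And>n. measure \<rho> {n<..} = h n" and sum: "summable (\<lambda>n. real (Suc n) * h n)"
  obtains M where "0 \<le> M" "(\<integral>\<^sup>+t. ennreal (real t) \<partial>\<rho>) = ennreal (suminf h)"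
    "(\<integral>\<^sup>+t. ennreal ((real t)\<^sup>2) \<partial>\<rho>) = ennreal M" 
proof
  have h: "0 \<le> h n" for n using tail[of n] by (metis measure_nonneg)
  have 1: "summable (\<lambda>s. 1 * measure \<rho> {s<..})"
    using h by (intro summable_comparison_test'[OF sum, of 0]) (auto simp: tail mult_left_mono algebra_simps)
  show "(\<integral>\<^sup>+t. ennreal (real t) \<partial>\<rho>) = ennreal (suminf h)"
    using nn_integral_nat_pmf_tail[OF _ 1] by (simp add: tail)
  have 2: "summable (\<lambda>s. (2 * real s + 1) * measure \<rho> {s<..})"
    using h by (intro summable_comparison_test'[OF summable_mult[OF sum, of 2], of 0])
      (auto simp: tail algebra_simps)
  have "(\<Sum>s<t. 2 * real s + 1) = (real t)\<^sup>2" for t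
    by (induction t) (auto simp: power2_eq_square algebra_simps)
  then show "(\<integral>\<^sup>+t. ennreal ((real t)\<^sup>2) \<partial>\<rho>) = ennreal (\<Sum>s. (2 * real s + 1) * h s)"
    using nn_integral_nat_pmf_tail[OF _ 2] by (simp add: tail)
  show "0 \<le> (\<Sum>s. (2 * real s + 1) * h s)"
    using 2 h by (intro suminf_nonneg) (auto simp: tail)
qed

primrec iid_sum_pmf :: "nat pmf \<Rightarrow> nat \<Rightarrow> nat pmf" where
  "iid_sum_pmf \<rho> 0 = return_pmf 0"
| "iid_sum_pmf \<rho> (Suc k) = bind_pmf \<rho> (\<lambda>t. map_pmf ((+) t) (iid_sum_pmf \<rho> k))"

lemma nn_integral_quadratic:
  fixes \<rho> :: "nat pmf"
  assumes "(\<integral>\<^sup>+t. ennreal (real t) \<partial>\<rho>) = ennreal m" "(\<integral>\<^sup>+t. ennreal ((real t)\<^sup>2) \<partial>\<rho>) = ennreal M"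
    and "0 \<le> m" "0 \<le> M" "0 \<le> a" "0 \<le> b" "0 \<le> c"
  shows "(\<integral>\<^sup>+t. ennreal (a * (real t)\<^sup>2 + b * real t + c) \<partial>\<rho>) = ennreal (a * M + b * m + c)"
  using assms by (simp add: ennreal_plus ennreal_mult nn_integral_add nn_integral_cmult)

text \<open>Conditioning on the first summand t, both s + t and its square are quadratics in s, and
  after integrating over s quadratics in t. Hence \<open>nn_integral_quadratic\<close> is applied
  twice for each moment.\<close>

lemma iid_sum_moments:
  fixes \<rho> :: "nat pmf"
  assumes 1: "(\<integral>\<^sup>+t. ennreal (real t) \<partial>\<rho>) = ennreal m"
    and 2: "(\<integral>\<^sup>+t. ennreal ((real t)\<^sup>2) \<partial>\<rho>) = ennreal M"
    and m: "0 \<le> m" "0 \<le> M"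
  shows "(\<integral>\<^sup>+s. ennreal (real s) \<partial>iid_sum_pmf \<rho> k) = ennreal (real k * m) \<and>
    (\<integral>\<^sup>+s. ennreal ((real s)\<^sup>2) \<partial>iid_sum_pmf \<rho> k) = ennreal (real k * M + real k * (real k - 1) * m\<^sup>2)"
proof (induction k)
  case (Suc k)
  define c where "c = real k * M + real k * (real k - 1) * m\<^sup>2"
  have c: "0 \<le> c" using m unfolding c_def by (cases k) auto
  have IH: "(\<integral>\<^sup>+s. ennreal (real s) \<partial>iid_sum_pmf \<rho> k) = ennreal (real k * m)"
    "(\<integral>\<^sup>+s. ennreal ((real s)\<^sup>2) \<partial>iid_sum_pmf \<rho> k) = ennreal c"
    using Suc by (auto simp: c_def)
  have "(\<integral>\<^sup>+s. ennreal (real s) \<partial>iid_sum_pmf \<rho> (Suc k)) =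
      (\<integral>\<^sup>+t. \<integral>\<^sup>+s. ennreal (0 * (real s)\<^sup>2 + 1 * real s + real t) \<partial>iid_sum_pmf \<rho> k \<partial>\<rho>)"
    by (simp add: add.commute)
  also have "\<dots> = (\<integral>\<^sup>+t. ennreal (0 * (real t)\<^sup>2 + 1 * real t + real k * m) \<partial>\<rho>)"
    using m c by (subst nn_integral_quadratic[OF IH]) (auto simp: add.commute)
  also have "\<dots> = ennreal (m + real k * m)"
    using m c by (subst nn_integral_quadratic[OF 1 2]) auto
  finally have A: "(\<integral>\<^sup>+s. ennreal (real s) \<partial>iid_sum_pmf \<rho> (Suc k)) = ennreal (real (Suc k) * m)"
    by (simp add: algebra_simps)
  have "(\<integral>\<^sup>+s. ennreal ((real s)\<^sup>2) \<partial>iid_sum_pmf \<rho> (Suc k)) =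
      (\<integral>\<^sup>+t. \<integral>\<^sup>+s. ennreal (1 * (real s)\<^sup>2 + 2 * real t * real s + (real t)\<^sup>2) \<partial>iid_sum_pmf \<rho> k \<partial>\<rho>)"
    by (simp add: power2_eq_square algebra_simps)
  also have "\<dots> = (\<integral>\<^sup>+t. ennreal (1 * (real t)\<^sup>2 + 2 * real k * m * real t + c) \<partial>\<rho>)"
    using m c by (subst nn_integral_quadratic[OF IH]) (auto simp: algebra_simps)
  also have "\<dots> = ennreal (M + 2 * real k * m * m + c)"
    using m c by (subst nn_integral_quadratic[OF 1 2]) auto
  also have "M + 2 * real k * m * m + c = real (Suc k) * M + real (Suc k) * (real (Suc k) - 1) * m\<^sup>2"
    by (simp add: c_def power2_eq_square algebra_simps)
  finally show ?case using A by simp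
qed simp

text \<open>The variance of the sum is k (M - m^2), bounded by k M.\<close>

lemma iid_sum_Chebyshev:
  fixes \<rho> :: "nat pmf"
  assumes "(\<integral>\<^sup>+t. ennreal (real t) \<partial>\<rho>) = ennreal m" "(\<integral>\<^sup>+t. ennreal ((real t)\<^sup>2) \<partial>\<rho>) = ennreal M"
    and m: "0 \<le> m" "0 \<le> M" and a: "0 < a"
  shows "measure (iid_sum_pmf \<rho> k) {s. a \<le> \<bar>real s - real k * m\<bar>} \<le> real k * M / a\<^sup>2"
proof -
  let ?S = "measure_pmf (iid_sum_pmf \<rho> k)"
  define c where "c = real k * M + real k * (real k - 1) * m\<^sup>2"
  have c: "0 \<le> c" using m unfolding c_def by (cases k) auto
  have nn: "(\<integral>\<^sup>+s. ennreal (real s) \<partial>?S) = ennreal (real k * m)"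
    "(\<integral>\<^sup>+s. ennreal ((real s)\<^sup>2) \<partial>?S) = ennreal c"
    using iid_sum_moments[OF assms(1-4), of k] by (auto simp: c_def)
  have int: "integrable ?S real" "integrable ?S (\<lambda>s. (real s)\<^sup>2)"
    using nn by (auto intro!: integrableI_nonneg)
  have E: "(\<integral>s. real s \<partial>?S) = real k * m" "(\<integral>s. (real s)\<^sup>2 \<partial>?S) = c"
    using nn c m by (auto simp: integral_eq_nn_integral)
  have "measure_pmf.variance (iid_sum_pmf \<rho> k) real = c - (real k * m)\<^sup>2"
    using measure_pmf.variance_eq[OF int] E by simp
  also have "\<dots> = real k * M - real k * m\<^sup>2"
    by (simp add: c_def power2_eq_square algebra_simps)
  also have "\<dots> \<le> real k * M" by simp
  finally have "measure_pmf.variance (iid_sum_pmf \<rho> k) real / a\<^sup>2 \<le> real k * M / a\<^sup>2"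
    by (intro divide_right_mono) auto
  then show ?thesis
    using measure_pmf.Chebyshev_inequality[of real "iid_sum_pmf \<rho> k", OF _ int(2) a] E by simp
qed

text \<open>Condition on the first summand: either it exceeds \<open>n\<close> alone, or it equals
  some t \<le> n and the other summands must exceed \<open>n - t\<close>. This is the recursion of
  \<open>renewal_tail\<close>.\<close>

lemma iid_sum_tail:
  fixes \<rho> :: "nat pmf"
  shows
  "measure (iid_sum_pmf \<rho> (Suc k)) {n<..} =
    measure \<rho> {n<..} + (\<Sum>t\<le>n. pmf \<rho> t * measure (iid_sum_pmf \<rho> k) {n - t<..})"
proof -
  let ?T = "\<lambda>n. measure (iid_sum_pmf \<rho> k) {n<..}"
  \<comment> \<open>Only finitely many values of the first summand need separate indicators, so its
    expectation becomes a finite sum.\<close>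
  have inner: "emeasure (map_pmf ((+) t) (iid_sum_pmf \<rho> k)) {n<..} =
      ennreal (indicator {n<..} t + (\<Sum>j\<le>n. indicator {j} t * ?T (n - j)))" for t
  proof (cases "n < t")
    case True
    have "((+) t) -` {n<..} = UNIV" using True by auto
    moreover have "(\<Sum>j\<le>n. indicator {j} t * ?T (n - j)) = 0"
      using True by (intro sum.neutral) (auto simp: indicator_def)
    ultimately show ?thesis using True by simp
  next
    case False
    have "((+) t) -` {n<..} = {n - t<..}" using False by auto
    moreover have "(\<Sum>j\<le>n. indicator {j} t * ?T (n - j)) = (\<Sum>j\<in>{t}. ?T (n - j))"
      using False by (intro sum.mono_neutral_cong_right) (auto simp: indicator_def)
    ultimately show ?thesis using False by (simp add: measure_pmf.emeasure_eq_measure)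
  qed
  have int: "integrable \<rho> (indicat_real A)" "integrable \<rho> (\<lambda>t. indicat_real A t * c)" for A c
    by (auto simp: less_top[symmetric])
  have "ennreal (measure (iid_sum_pmf \<rho> (Suc k)) {n<..}) =
      (\<integral>\<^sup>+t. ennreal (indicator {n<..} t + (\<Sum>j\<le>n. indicator {j} t * ?T (n - j))) \<partial>\<rho>)"
    by (simp only: measure_pmf.emeasure_eq_measure[symmetric] iid_sum_pmf.simps emeasure_bind_pmf inner)
  also have "\<dots> = ennreal (\<integral>t. indicator {n<..} t + (\<Sum>j\<le>n. indicator {j} t * ?T (n - j)) \<partial>\<rho>)"
    by (intro nn_integral_eq_integral Bochner_Integration.integrable_add
          Bochner_Integration.integrable_sum int AE_I2 add_nonneg_nonneg sum_nonneg) auto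
  also have "(\<integral>t. indicator {n<..} t + (\<Sum>j\<le>n. indicator {j} t * ?T (n - j)) \<partial>\<rho>) =
      measure \<rho> {n<..} + (\<Sum>j\<le>n. pmf \<rho> j * ?T (n - j))"
    by (subst Bochner_Integration.integral_add Bochner_Integration.integral_sum;
        (intro Bochner_Integration.integrable_sum int)?)+
       (simp add: measure_pmf_single)
  finally show ?thesis
    by (subst (asm) ennreal_inj) (auto intro!: add_nonneg_nonneg sum_nonneg)
qed

section \<open>The mean row time and Chebyshev bounds for the renewal tails\<close>

definition mean_time :: "real \<Rightarrow> real" where
  "mean_time p = (\<Sum>n. survival p n {#} 0)"

lemma summable_survival:
  assumes "0 < p" "p < 1"
  shows "summable (\<lambda>n. survival p n {#} 0)"
  using survival_nonneg[of p] assms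
  by (intro summable_comparison_test'[OF summable_Suc_survival[OF assms], of 0])
     (auto simp: mult_left_mono algebra_simps)

lemma mean_time_ge_1:
  assumes "0 < p" "p < 1"
  shows "1 \<le> mean_time p"
proof -
  have "(\<Sum>n<1. survival p n {#} 0) \<le> mean_time p"
    unfolding mean_time_def using survival_nonneg[of p] assms
    by (intro sum_le_suminf summable_survival) auto
  then show ?thesis by (simp add: visit_weight_def)
qed

text \<open>The series are compared term by term. At n = 0 both survival probabilities are 1, so the
  strict gap is taken at n = 1.\<close>

lemma mean_time_strict_antimono:
  assumes "0 < p" "p < p'" "p' < 1"
  shows "mean_time p' < mean_time p"
proof -
  let ?d = "\<lambda>n. survival p n {#} 0 - survival p' n {#} 0"
  have s: "summable (\<lambda>n. survival p n {#} 0)" "summable (\<lambda>n. survival p' n {#} 0)"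
    using assms by (auto intro: summable_survival)
  have "0 < suminf ?d"
    using assms survival_1[of p] survival_1[of p']
    by (intro suminf_pos2[where i = 1] summable_diff s) (auto intro: survival_antimono)
  then show ?thesis
    using s by (simp add: mean_time_def suminf_diff[symmetric])
qed

text \<open>With \<open>survival\<close> as the tail of a law, \<open>renewal_tail\<close> is the
  tail of its k-fold sum, and Chebyshev applies on either side of the mean
  \<open>real k * mean_time p\<close>.\<close>

lemma renewal_tail_bounds:
  assumes p: "0 < p" "p < 1"
  obtains V where "0 \<le> V"
    "\<And>k n. real k * mean_time p < real n \<Longrightarrow>
      renewal_tail p k n \<le> real k * V / (real n - real k * mean_time p)\<^sup>2"
    "\<And>k n. real n < real k * mean_time p \<Longrightarrow>
      1 - renewal_tail p k n \<le> real k * V / (real k * mean_time p - real n)\<^sup>2"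
proof -
  let ?h = "\<lambda>n. survival p n {#} 0"
  have lim: "?h \<longlonglongrightarrow> 0"
    using summable_survival[OF p] by (rule summable_LIMSEQ_zero)
  have h0: "?h 0 = 1" by (simp add: visit_weight_def)
  have dec: "?h (Suc n) \<le> ?h n" for n
    using p by (intro survival_Suc_le) auto
  obtain \<rho> where \<rho>: "pmf \<rho> 0 = 0" "\<And>t. pmf \<rho> (Suc t) = ?h t - ?h (Suc t)"
      "\<And>n. measure \<rho> {n<..} = ?h n"
    by (rule tail_pmf_exists[of ?h, OF h0 dec lim], rule that)
  obtain V where V: "0 \<le> V" "(\<integral>\<^sup>+t. ennreal (real t) \<partial>\<rho>) = ennreal (mean_time p)"
      "(\<integral>\<^sup>+t. ennreal ((real t)\<^sup>2) \<partial>\<rho>) = ennreal V"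
    by (rule nat_pmf_moments[OF \<rho>(3) summable_Suc_survival[OF p]], rule that)
       (simp_all add: mean_time_def)
  have tail: "renewal_tail p k n = measure (iid_sum_pmf \<rho> k) {n<..}" for k n
  proof (induction k arbitrary: n)
    case (Suc k)
    \<comment> \<open>A row time is at least 1: there is no mass at 0, and the sum is reindexed by
      the successor.\<close>
    have "(\<Sum>t\<le>n. pmf \<rho> t * measure (iid_sum_pmf \<rho> k) {n - t<..}) =
        (\<Sum>t<n. (?h t - ?h (Suc t)) * measure (iid_sum_pmf \<rho> k) {n - Suc t<..})"
      unfolding lessThan_Suc_atMost[symmetric]
      by (subst sum.lessThan_Suc_shift) (simp add: \<rho>)
    then show ?case
      unfolding iid_sum_tail \<rho>(3) renewal_tail.simps Suc by simp
  qed simp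
  note Cheb = iid_sum_Chebyshev[OF V(2,3) _ V(1)]
  show thesis
  proof (rule that[OF V(1)])
    fix k n :: nat
    assume *: "real k * mean_time p < real n"
    have "renewal_tail p k n \<le> measure (iid_sum_pmf \<rho> k)
        {s. real n - real k * mean_time p \<le> \<bar>real s - real k * mean_time p\<bar>}"
      unfolding tail by (intro measure_pmf.finite_measure_mono) auto
    also have "\<dots> \<le> real k * V / (real n - real k * mean_time p)\<^sup>2"
      using * mean_time_ge_1[OF p] by (intro Cheb) auto
    finally show "renewal_tail p k n \<le> real k * V / (real n - real k * mean_time p)\<^sup>2" .
  next
    fix k n :: nat
    assume *: "real n < real k * mean_time p"
    have "UNIV - {n<..} = {..n}" by auto
    then have "1 - renewal_tail p k n = measure (iid_sum_pmf \<rho> k) {..n}"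
      using measure_pmf.prob_compl[of "{n<..}" "iid_sum_pmf \<rho> k"] by (simp add: tail)
    also have "\<dots> \<le> measure (iid_sum_pmf \<rho> k)
        {s. real k * mean_time p - real n \<le> \<bar>real s - real k * mean_time p\<bar>}"
      by (intro measure_pmf.finite_measure_mono) auto
    also have "\<dots> \<le> real k * V / (real k * mean_time p - real n)\<^sup>2"
      using * mean_time_ge_1[OF p] by (intro Cheb) auto
    finally show "1 - renewal_tail p k n \<le> real k * V / (real k * mean_time p - real n)\<^sup>2" .
  qed
qed

section \<open>Almost sure convergence along squares\<close>

text \<open>With countably many tolerances, almost-sure quantifiers can be exchanged and convergence
  events are measurable.\<close>

lemma LIMSEQ_iff_inverse_Suc:
  fixes f :: "nat \<Rightarrow> 'a::metric_space"
  shows "f \<longlonglongrightarrow> c \<longleftrightarrow> (\<forall>r::nat. \<exists>N. \<forall>n\<ge>N. dist (f n) c < inverse (real (Suc r)))"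
proof
  assume "\<forall>r::nat. \<exists>N. \<forall>n\<ge>N. dist (f n) c < inverse (real (Suc r))"
  then show "f \<longlonglongrightarrow> c"
    unfolding lim_sequentially by (meson reals_Archimedean order.strict_trans)
qed (auto simp: lim_sequentially)

text \<open>A time n lies at most 2j steps after the last square j^2, so \<open>z\<close> has moved
  by at most 2jL since then, which is negligible against j^2.\<close>

lemma LIMSEQ_div_from_squares:
  fixes z :: "nat \<Rightarrow> real"
  assumes lip: "\<And>n. \<bar>z (Suc n) - z n\<bar> \<le> L"
    and lim: "(\<lambda>j. z (j\<^sup>2) / real (j\<^sup>2)) \<longlonglongrightarrow> 0"
  shows "(\<lambda>n. z n / real n) \<longlonglongrightarrow> 0"
proof (rule tendsto_rabs_zero_cancel, rule tendsto_sandwich[of "\<lambda>_. 0"])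
  have dist: "\<bar>z (m + d) - z m\<bar> \<le> real d * L" for m d
  proof (induction d)
    case (Suc d)
    then show ?case using lip[of "m + d"] by (simp add: algebra_simps)
  qed simp
  have L: "0 \<le> L" using lip[of 0] by linarith
  have fs: "filterlim floor_sqrt at_top sequentially"
    unfolding filterlim_at_top eventually_sequentially
  proof (intro allI exI impI)
    fix k n :: nat assume "k\<^sup>2 \<le> n"
    then show "k \<le> floor_sqrt n" using mono_floor_sqrt'[of "k\<^sup>2" n] by simp
  qed
  have "(\<lambda>j. \<bar>z (j\<^sup>2) / real (j\<^sup>2)\<bar> + 2 * L / real j) \<longlonglongrightarrow> 0"
    using tendsto_add[OF tendsto_rabs_zero[OF lim] lim_const_over_n[of "2 * L"]] by simp
  then show "(\<lambda>n. \<bar>z ((floor_sqrt n)\<^sup>2) / real ((floor_sqrt n)\<^sup>2)\<bar> + 2 * L / real (floor_sqrt n)) \<longlonglongrightarrow> 0"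
    by (rule filterlim_compose[OF _ fs])
  show "\<forall>\<^sub>F n in sequentially. \<bar>z n / real n\<bar> \<le>
      \<bar>z ((floor_sqrt n)\<^sup>2) / real ((floor_sqrt n)\<^sup>2)\<bar> + 2 * L / real (floor_sqrt n)"
  proof (rule eventually_sequentiallyI[of 1])
    fix n :: nat assume n: "1 \<le> n"
    define j where "j = floor_sqrt n"
    have j: "1 \<le> j" "j\<^sup>2 \<le> n" "n \<le> j\<^sup>2 + 2 * j"
      using n mono_floor_sqrt'[of 1 n] floor_sqrt_power2_le[of n] Suc_floor_sqrt_power2_gt[of n]
      by (auto simp: j_def power2_eq_square)
    have "\<bar>z n\<bar> \<le> \<bar>z (j\<^sup>2)\<bar> + real (n - j\<^sup>2) * L"
      using dist[of "j\<^sup>2" "n - j\<^sup>2"] j by simp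
    also have "real (n - j\<^sup>2) * L \<le> real (2 * j) * L"
      using j(3) L by (intro mult_right_mono of_nat_mono) linarith+
    finally have "\<bar>z n\<bar> / real n \<le> (\<bar>z (j\<^sup>2)\<bar> + real (2 * j) * L) / real n"
      by (intro divide_right_mono) auto
    also have "\<dots> \<le> (\<bar>z (j\<^sup>2)\<bar> + real (2 * j) * L) / real (j\<^sup>2)"
      using n j L by (intro divide_left_mono mult_pos_pos) auto
    also have "\<dots> = \<bar>z (j\<^sup>2) / real (j\<^sup>2)\<bar> + 2 * L / real j"
      using j by (simp add: field_simps power2_eq_square)
    finally show "\<bar>z n / real n\<bar> \<le>
        \<bar>z ((floor_sqrt n)\<^sup>2) / real ((floor_sqrt n)\<^sup>2)\<bar> + 2 * L / real (floor_sqrt n)"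
      by (simp add: j_def)
  qed
qed auto

text \<open>Bounds C/n are not summable over all n but are along n = j^2. Borel-Cantelli for each
  tolerance gives convergence there, and the bounded increments do the rest.\<close>

lemma (in prob_space) AE_LIMSEQ_div_zero:
  fixes Z :: "nat \<Rightarrow> 'a \<Rightarrow> real"
  assumes [measurable]: "\<And>n. Z n \<in> borel_measurable M"
    and lip: "AE x in M. \<forall>n. \<bar>Z (Suc n) x - Z n x\<bar> \<le> L"
    and dev: "\<And>\<epsilon>. 0 < \<epsilon> \<Longrightarrow> \<exists>C. \<forall>n\<ge>1. prob {x \<in> space M. \<epsilon> * real n \<le> \<bar>Z n x\<bar>} \<le> C / real n"
  shows "AE x in M. (\<lambda>n. Z n x / real n) \<longlonglongrightarrow> 0"
proof -
  have "AE x in M. \<forall>r::nat. \<exists>N. \<forall>j\<ge>N. dist (Z (j\<^sup>2) x / real (j\<^sup>2)) 0 < inverse (real (Suc r))"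
  proof (subst AE_all_countable, rule allI)
    fix r :: nat
    let ?\<epsilon> = "inverse (real (Suc r))"
    let ?A = "\<lambda>j. {x \<in> space M. ?\<epsilon> * real (j\<^sup>2) \<le> \<bar>Z (j\<^sup>2) x\<bar>}"
    obtain C where C: "\<And>n. 1 \<le> n \<Longrightarrow> prob {x \<in> space M. ?\<epsilon> * real n \<le> \<bar>Z n x\<bar>} \<le> C / real n"
      using dev[of ?\<epsilon>] by auto
    have "summable (\<lambda>j. C * inverse (real j ^ 2))"
      by (intro summable_mult inverse_power_summable) auto
    then have "summable (\<lambda>j. prob (?A j))"
    proof (rule summable_comparison_test'[where N = 1])
      fix j :: nat assume "1 \<le> j"
      then show "norm (prob (?A j)) \<le> C * inverse (real j ^ 2)"
        using C[of "j\<^sup>2"] by (simp add: divide_inverse)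
    qed
    then have "AE x in M. eventually (\<lambda>j. x \<in> space M - ?A j) sequentially"
      by (intro borel_cantelli_AE1) (auto simp: less_top[symmetric])
    then show "AE x in M. \<exists>N. \<forall>j\<ge>N. dist (Z (j\<^sup>2) x / real (j\<^sup>2)) 0 < ?\<epsilon>"
    proof eventually_elim
      case (elim x)
      then obtain N where N: "\<And>j. N \<le> j \<Longrightarrow> \<bar>Z (j\<^sup>2) x\<bar> < ?\<epsilon> * real (j\<^sup>2)"
        by (auto simp: eventually_sequentially not_le)
      have "dist (Z (j\<^sup>2) x / real (j\<^sup>2)) 0 < ?\<epsilon>" if "max 1 N \<le> j" for j
        using N[of j] that by (simp add: pos_divide_less_eq)
      then show ?case by blast
    qed
  qed
  with lip show ?thesis
  proof eventually_elim
    case (elim x)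
    then show ?case
      by (intro LIMSEQ_div_from_squares[of "\<lambda>n. Z n x"]) (simp_all only: LIMSEQ_iff_inverse_Suc, auto)
  qed
qed

section \<open>The quenched walk in a good environment\<close>

definition drilled :: "site set" where "drilled = {e1, - e1, - e2}"
definition plain :: "site set" where "plain = {e1, - e1}"

text \<open>The product space contains arbitrary step sets; the pathwise arguments below run on this
  almost sure event.\<close>

definition good_env :: "(site \<Rightarrow> site set) \<Rightarrow> bool" where
  "good_env G \<longleftrightarrow> (\<forall>x. G x = drilled \<or> G x = plain)"

lemma good_envD: "good_env G \<Longrightarrow> G x = drilled \<or> G x = plain"
  unfolding good_env_def by blast

lemma good_env_finite: "good_env G \<Longrightarrow> finite (G x)" "good_env G \<Longrightarrow> G x \<noteq> {}"
  unfolding good_env_def drilled_def plain_def by (metis finite.emptyI finite_insert, metis insert_not_empty)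

lemma AE_good_env: "AE G in environment (step_set_law p). good_env G"
  unfolding good_env_def
proof (subst AE_all_countable, rule allI)
  fix x
  have "AE S in measure_pmf (step_set_law p). S = drilled \<or> S = plain"
    by (rule AE_pmfI) (auto simp: step_set_law_def drilled_def plain_def)
  then show "AE G in environment (step_set_law p). G x = drilled \<or> G x = plain"
    unfolding environment_def
    by (intro AE_PiM_component) (auto simp: measure_pmf.prob_space_axioms)
qed

lemma nn_integral_walk_Suc:
  assumes "finite (G z)" "G z \<noteq> {}"
  shows "(\<integral>\<^sup>+y. f y \<partial>walk_pmf G (Suc n) z) =
    (\<Sum>e\<in>G z. \<integral>\<^sup>+y. f y \<partial>walk_pmf G n (z + e)) / card (G z)"
  using assms by (simp add: transition_def nn_integral_pmf_of_set)

lemma ennreal_average: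
  assumes "finite S" "S \<noteq> {}" "\<And>e. 0 \<le> g e"
  shows "(\<Sum>e\<in>S. ennreal (g e)) / of_nat (card S) = ennreal ((\<Sum>e\<in>S. g e) / real (card S))"
  using assms
  by (simp add: sum_ennreal divide_ennreal ennreal_of_nat_eq_real_of_nat card_gt_0_iff sum_nonneg)

lemma measure_walk_Suc:
  assumes "finite (G z)" "G z \<noteq> {}"
  shows "measure (walk_pmf G (Suc n) z) A = (\<Sum>e\<in>G z. measure (walk_pmf G n (z + e)) A) / card (G z)"
proof -
  have "ennreal (measure (walk_pmf G (Suc n) z) A) =
      (\<Sum>e\<in>G z. ennreal (measure (walk_pmf G n (z + e)) A)) / card (G z)"
    using nn_integral_walk_Suc[where f = "indicator A", of G z n, OF assms]
    by (simp add: measure_pmf.emeasure_eq_measure del: walk_pmf.simps)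
  also have "\<dots> = ennreal ((\<Sum>e\<in>G z. measure (walk_pmf G n (z + e)) A) / card (G z))"
    using assms by (intro ennreal_average) auto
  finally show ?thesis
    by (subst (asm) ennreal_inj) (auto intro!: divide_nonneg_nonneg sum_nonneg)
qed

lemma
  fixes f :: "site \<Rightarrow> real"
  shows sum_plain: "(\<Sum>e\<in>plain. f e) = f e1 + f (- e1)"
    and sum_drilled: "(\<Sum>e\<in>drilled. f e) = f e1 + f (- e1) + f (- e2)" 
  by (simp_all add: plain_def drilled_def e1_def e2_def uminus_prod_def)

lemma card_plain: "card plain = 2" and card_drilled: "card drilled = 3"
  by (simp_all add: plain_def drilled_def e1_def e2_def uminus_prod_def)

lemma keep_good: "G z = drilled \<Longrightarrow> keep G z = 2 / 3" "G z = plain \<Longrightarrow> keep G z = 1"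
  by (auto simp: keep_def plain_def drilled_def e1_def e2_def uminus_prod_def)

lemma snd_walk_le: "good_env G \<Longrightarrow> y \<in> set_pmf (walk_pmf G n z) \<Longrightarrow> snd y \<le> snd z"
proof (induction n arbitrary: z)
  case (Suc n)
  then obtain e where e: "e \<in> G z" "y \<in> set_pmf (walk_pmf G n (z + e))"
    using good_env_finite by (auto simp: transition_def)
  have "snd e \<le> 0"
  proof -
    have "e \<in> drilled \<union> plain" using e(1) good_envD[OF Suc.prems(1), of z] by auto
    then show ?thesis by (auto simp: plain_def drilled_def e1_def e2_def)
  qed
  with Suc.IH[OF Suc.prems(1) e(2)] show ?case by simp
qed simp

text \<open>First-step analysis. A drilled site has \<open>keep\<close> equal to 2/3, so each of its
  three moves gets weight 1/3; a plain site has \<open>keep\<close> equal to 1, so its two moves get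
  1/2.\<close>

lemma measure_walk_eq_above_prob:
  "good_env G \<Longrightarrow> measure (walk_pmf G n z) {y. snd z - snd y < int k} = above_prob G k n z"
proof (induction n arbitrary: k z)
  case 0
  then show ?case by (cases k) auto
next
  case (Suc n)
  show ?case
  proof (cases k)
    \<comment> \<open>The event would require the walk to be above its starting row, which
      \<open>snd_walk_le\<close> excludes.\<close>
    case 0
    then show ?thesis
      using snd_walk_le[OF Suc.prems, of _ "Suc n" z] by (fastforce simp: measure_pmf_zero_iff simp del: walk_pmf.simps)
  next
    case k: (Suc l)
    let ?A = "{y. snd z - snd y < int (Suc l)}"
    have snd: "snd (z + e1) = snd z" "snd (z + - e1) = snd z"
      by (simp_all add: e1_def)
    have "measure (walk_pmf G n (z + e1)) ?A = above_prob G (Suc l) n (z + e1)"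
      "measure (walk_pmf G n (z + - e1)) ?A = above_prob G (Suc l) n (z - e1)"
      using Suc.IH[OF Suc.prems, of "z + e1" "Suc l"] Suc.IH[OF Suc.prems, of "z + - e1" "Suc l"]
      unfolding snd by simp_all
    moreover have A: "?A = {y. snd (z + - e2) - snd y < int l}"
      by (auto simp: e2_def)
    have "measure (walk_pmf G n (z + - e2)) ?A = above_prob G l n (z - e2)"
      unfolding A using Suc.IH[OF Suc.prems, of "z + - e2" l] by simp
    ultimately show ?thesis
      using good_envD[OF Suc.prems, of z] good_env_finite[OF Suc.prems, of z] unfolding k
      by (subst measure_walk_Suc)
         (auto simp: sum_plain sum_drilled card_plain card_drilled keep_good field_simps)
  qed
qed

text \<open>Horizontal moves are symmetric and add 1 to the mean square; a descent adds nothing.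
  Hence each step adds at most 1.\<close>

lemma nn_integral_fst_walk:
  assumes "good_env G"
  shows "(\<integral>\<^sup>+y. ennreal ((real_of_int (fst y))\<^sup>2) \<partial>walk_pmf G n z) \<le> ennreal ((real_of_int (fst z))\<^sup>2 + real n)"
proof (induction n arbitrary: z)
  case (Suc n)
  let ?f = "\<lambda>z. (real_of_int (fst z))\<^sup>2 + real n"
  have "(\<integral>\<^sup>+y. ennreal ((real_of_int (fst y))\<^sup>2) \<partial>walk_pmf G (Suc n) z) \<le>
      (\<Sum>e\<in>G z. ennreal (?f (z + e))) / card (G z)"
    unfolding nn_integral_walk_Suc[of G z, OF good_env_finite[OF assms]]
    by (intro divide_right_mono_ennreal sum_mono Suc)
  also have "\<dots> = ennreal ((\<Sum>e\<in>G z. ?f (z + e)) / card (G z))"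
    using good_env_finite[OF assms] by (intro ennreal_average) auto
  also have "(\<Sum>e\<in>G z. ?f (z + e)) / card (G z) \<le> (real_of_int (fst z))\<^sup>2 + real (Suc n)"
    using good_envD[OF assms, of z]
    by (auto simp: sum_plain sum_drilled card_plain card_drilled e1_def e2_def power2_eq_square
        field_simps)
  finally show ?case by (simp add: ennreal_leI)
qed simp

lemma walk_fst_deviation:
  assumes "good_env G" "0 < a"
  shows "measure (walk_pmf G n 0) {y. a \<le> \<bar>real_of_int (fst y)\<bar>} \<le> real n / a\<^sup>2"
proof -
  have "emeasure (walk_pmf G n 0) {y. a \<le> \<bar>real_of_int (fst y)\<bar>} \<le>
      emeasure (walk_pmf G n 0) {y\<in>UNIV. 1 \<le> ennreal (1 / a\<^sup>2) * ennreal ((real_of_int (fst y))\<^sup>2)}"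
  proof (rule emeasure_mono, safe)
    fix y1 y2 :: int assume "a \<le> \<bar>real_of_int (fst (y1, y2))\<bar>"
    then have "a\<^sup>2 \<le> (real_of_int y1)\<^sup>2"
      using assms by (metis abs_le_square_iff abs_of_pos fst_conv)
    then show "1 \<le> ennreal (1 / a\<^sup>2) * ennreal ((real_of_int (fst (y1, y2)))\<^sup>2)"
      using assms by (simp add: ennreal_mult[symmetric] del: ennreal_1 flip: ennreal_1)
  qed auto
  also have "\<dots> \<le> ennreal (1 / a\<^sup>2) * (\<integral>\<^sup>+y. ennreal ((real_of_int (fst y))\<^sup>2) * indicator UNIV y \<partial>walk_pmf G n 0)"
    by (rule nn_integral_Markov_inequality) auto
  also have "\<dots> \<le> ennreal (1 / a\<^sup>2) * ennreal (real n)"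
    using nn_integral_fst_walk[OF assms(1), of n 0] by (intro mult_left_mono) auto
  finally show ?thesis
    using assms by (simp add: measure_pmf.emeasure_eq_measure ennreal_mult[symmetric])
qed

section \<open>The annealed walk\<close>

lemma measurable_annealed_position [measurable]:
  "(\<lambda>X. X n) \<in> annealed \<mu> \<rightarrow>\<^sub>M count_space (UNIV :: site set)"
  "(\<lambda>X. X n) \<in> path_space \<rightarrow>\<^sub>M count_space (UNIV :: site set)"
proof -
  show "(\<lambda>X. X n) \<in> path_space \<rightarrow>\<^sub>M count_space (UNIV :: site set)"
    by (simp add: path_space_def)
  then show "(\<lambda>X. X n) \<in> annealed \<mu> \<rightarrow>\<^sub>M count_space (UNIV :: site set)"
    by (simp cong: measurable_cong_sets[OF sets_annealed refl])
qed

lemma space_annealed: "space (annealed \<mu>) = UNIV"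
  using sets_eq_imp_space_eq[OF sets_annealed] by simp

lemma AE_annealedI:
  assumes "Measurable.pred path_space P"
    and "\<And>G. good_env G \<Longrightarrow> AE X in quenched G. P X"
  shows "AE X in annealed (step_set_law p). P X"
  unfolding annealed_def AE_bind[OF measurable_quenched assms(1)]
  using AE_good_env by eventually_elim (rule assms(2))

lemma AE_annealed_step:
  "AE X in annealed (step_set_law p). \<forall>n. X (Suc n) - X n \<in> drilled"
proof (rule AE_annealedI)
  fix G assume G: "good_env G"
  have "AE X in quenched G. \<forall>n. X (Suc n) - X n \<in> G (X n)"
    using good_env_finite[OF G] by (intro AE_quenched_step) auto
  then show "AE X in quenched G. \<forall>n. X (Suc n) - X n \<in> drilled"
  proof eventually_elim
    case (elim X)
    have "G x \<subseteq> drilled" for x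
      using good_envD[OF G, of x] by (auto simp: plain_def drilled_def)
    with elim show ?case by blast
  qed
qed measurable

text \<open>The deviation estimates concern a single time, so the annealed law enters them only
  through this mixture of \<open>walk_pmf\<close>.\<close>

lemma measure_annealed_position:
  "ennreal (measure (annealed (step_set_law p)) {X. X n \<in> A}) =
    (\<integral>\<^sup>+G. ennreal (measure (walk_pmf G n 0) A) \<partial>environment (step_set_law p))"
proof -
  interpret A: prob_space "annealed (step_set_law p)" by (rule prob_space_annealed)
  have "{X \<in> space path_space. X n \<in> A} \<in> sets path_space" by measurable
  then have A: "{X. X n \<in> A} \<in> sets path_space" by simp
  have "emeasure (quenched G) {X. X n \<in> A} = ennreal (measure (walk_pmf G n 0) A)" for G
  proof -
    have "(\<lambda>X. X n) \<in> quenched G \<rightarrow>\<^sub>M count_space (UNIV :: site set)"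
      by simp
    then have "emeasure (quenched G) {X. X n \<in> A} =
        emeasure (distr (quenched G) (count_space UNIV) (\<lambda>X. X n)) A"
      by (simp add: emeasure_distr vimage_def)
    then show ?thesis
      by (simp add: distr_position measure_pmf.emeasure_eq_measure)
  qed
  then show ?thesis
    by (simp add: A.emeasure_eq_measure[symmetric] emeasure_annealed[OF A])
qed

lemma measure_annealed_fst:
  assumes "0 < a"
  shows "measure (annealed (step_set_law p)) {X. a \<le> \<bar>real_of_int (fst (X n))\<bar>} \<le> real n / a\<^sup>2"
proof -
  interpret E: prob_space "environment (step_set_law p)" by (rule prob_space_environment)
  have "ennreal (measure (annealed (step_set_law p)) {X. X n \<in> {y. a \<le> \<bar>real_of_int (fst y)\<bar>}}) \<le>
      (\<integral>\<^sup>+G. ennreal (real n / a\<^sup>2) \<partial>environment (step_set_law p))"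
    unfolding measure_annealed_position
    by (intro nn_integral_mono_AE eventually_mono[OF AE_good_env] ennreal_leI walk_fst_deviation assms)
  then show ?thesis
    using E.emeasure_space_1 by simp
qed

text \<open>The link to the renewal description: depth below \<open>k\<close> at time
  \<open>n\<close> means that the first \<open>k\<close> row times add up to more than
  \<open>n\<close>.\<close>

lemma measure_annealed_snd:
  assumes "0 \<le> p" "p \<le> 1"
  shows "measure (annealed (step_set_law p)) {X. - snd (X n) < int k} = renewal_tail p k n"
proof -
  interpret E: prob_space "environment (step_set_law p)" by (rule prob_space_environment)
  have "ennreal (measure (annealed (step_set_law p)) {X. X n \<in> {y. snd (0::site) - snd y < int k}}) =
      (\<integral>\<^sup>+G. ennreal (above_prob G k n 0) \<partial>environment (step_set_law p))"
    unfolding measure_annealed_position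
    by (intro nn_integral_cong_AE eventually_mono[OF AE_good_env])
       (simp only: measure_walk_eq_above_prob)
  also have "\<dots> = ennreal (\<integral>G. above_prob G k n 0 \<partial>environment (step_set_law p))"
    using above_prob_bounds by (intro nn_integral_eq_integral E.integrable_const_bound[of _ 1]) auto
  also have "\<dots> = ennreal (renewal_tail p k n)"
    by (simp only: integral_above_prob[OF assms])
  finally have "ennreal (measure (annealed (step_set_law p)) {X. X n \<in> {y. snd (0::site) - snd y < int k}}) =
    ennreal (renewal_tail p k n)" .
  moreover have "0 \<le> renewal_tail p k n"
    using above_prob_bounds integral_above_prob[OF assms, of k n 0]
    by (metis Bochner_Integration.integral_nonneg)
  ultimately show ?thesis by simp
qed

text \<open>Depth is the inverse of accumulated row time. A depth error \<epsilon> n becomes a time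
  error of order \<epsilon> m n for a sum of about (1/m + \<epsilon>) n or (1/m - \<epsilon>) n row
  times, which \<open>renewal_tail_bounds\<close> controls.\<close>

lemma annealed_snd_deviation:
  assumes p: "0 < p" "p < 1" and \<epsilon>: "0 < \<epsilon>"
  shows "\<exists>C. \<forall>n\<ge>1. measure (annealed (step_set_law p))
    {X. \<epsilon> * real n \<le> \<bar>- real_of_int (snd (X n)) - real n / mean_time p\<bar>} \<le> C / real n"
proof -
  interpret A: prob_space "annealed (step_set_law p)" by (rule prob_space_annealed)
  define m where "m = mean_time p"
  have m: "1 \<le> m" using mean_time_ge_1[OF p] by (simp add: m_def)
  obtain V where "0 \<le> V"
    "\<And>k n. real k * mean_time p < real n \<Longrightarrow>
      renewal_tail p k n \<le> real k * V / (real n - real k * mean_time p)\<^sup>2"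
    "\<And>k n. real n < real k * mean_time p \<Longrightarrow>
      1 - renewal_tail p k n \<le> real k * V / (real k * mean_time p - real n)\<^sup>2"
    by (rule renewal_tail_bounds[OF p], rule that)
  note V = this[folded m_def]
  \<comment> \<open>In \<open>C1\<close>, the summand 1 pays for rounding k up. In
    \<open>C2\<close>, rounding costs up to half of the time gap, whence the factor 4; the term
    2/\<epsilon> makes the bound trivial for n < 2/\<epsilon>.\<close>
  define C1 where "C1 = (1 / m + \<epsilon> + 1) * V / (\<epsilon> * m)\<^sup>2"
  define C2 where "C2 = 4 * V / (\<epsilon> * m)\<^sup>2 + 2 / \<epsilon>"
  have sets: "{X. Q (X n)} \<in> A.events" for n and Q :: "site \<Rightarrow> bool"
  proof -
    have "{X \<in> space (annealed (step_set_law p)). Q (X n)} \<in> A.events" by measurable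
    then show ?thesis by (simp add: space_annealed)
  qed
  have snd_prob: "A.prob {X. - snd (X n) < int k} = renewal_tail p k n" for k n
    using p by (intro measure_annealed_snd) auto
  have below: "A.prob {X. real n / m + \<epsilon> * real n \<le> - real_of_int (snd (X n))} \<le> C1 / real n"
    if n: "1 \<le> n" for n
  proof -
    define k where "k = nat \<lceil>real n / m + \<epsilon> * real n\<rceil>"
    have k: "real n / m + \<epsilon> * real n \<le> real k" "real k \<le> real n / m + \<epsilon> * real n + 1"
      using m \<epsilon> unfolding k_def by (auto intro: of_nat_ceiling simp: add_nonneg_nonneg)
    have km: "\<epsilon> * m * real n \<le> real k * m - real n"
    proof -
      have "(real n / m + \<epsilon> * real n) * m = real n + \<epsilon> * m * real n"
        using m by (simp add: distrib_right)
      then show ?thesis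
        using mult_right_mono[OF k(1), of m] m by linarith
    qed
    have pos: "0 < \<epsilon> * m * real n" using m \<epsilon> n by simp
    have "A.prob {X. real n / m + \<epsilon> * real n \<le> - real_of_int (snd (X n))} \<le>
        A.prob (space (annealed (step_set_law p)) - {X. - snd (X n) < int k})"
    proof (rule A.finite_measure_mono)
      show "space (annealed (step_set_law p)) - {X. - snd (X n) < int k} \<in> A.events"
        by (intro sets.compl_sets sets)
      show "{X. real n / m + \<epsilon> * real n \<le> - real_of_int (snd (X n))} \<subseteq>
          space (annealed (step_set_law p)) - {X. - snd (X n) < int k}"
      proof (rule subsetI, unfold mem_Collect_eq space_annealed, rule DiffI[OF UNIV_I], rule notI, unfold mem_Collect_eq)
        fix X :: "nat \<Rightarrow> site"
        assume "real n / m + \<epsilon> * real n \<le> - real_of_int (snd (X n))" and less: "- snd (X n) < int k"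
        then have "\<lceil>real n / m + \<epsilon> * real n\<rceil> \<le> - snd (X n)"
          by (simp add: ceiling_le_iff)
        moreover have "0 \<le> real n / m + \<epsilon> * real n" using m \<epsilon> by simp
        then have "int k = \<lceil>real n / m + \<epsilon> * real n\<rceil>" unfolding k_def by simp
        ultimately show False using less by simp
      qed
    qed
    also have "\<dots> = 1 - renewal_tail p k n"
      using sets by (subst A.prob_compl) (auto simp: snd_prob)
    also have "\<dots> \<le> real k * V / (real k * m - real n)\<^sup>2"
      using km pos by (intro V(3)) linarith
    also have "\<dots> \<le> ((1 / m + \<epsilon> + 1) * real n * V) / (\<epsilon> * m * real n)\<^sup>2"
    proof (rule frac_le)
      have "real k \<le> (1 / m + \<epsilon> + 1) * real n"
        using k(2) n by (simp add: algebra_simps)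
      then show "real k * V \<le> (1 / m + \<epsilon> + 1) * real n * V"
        using V(1) by (rule mult_right_mono)
      show "(\<epsilon> * m * real n)\<^sup>2 \<le> (real k * m - real n)\<^sup>2"
        using km pos by (intro power_mono) auto
    qed (use n V m \<epsilon> in auto)
    also have "\<dots> = C1 / real n"
      using n by (simp add: C1_def power2_eq_square)
    finally show ?thesis .
  qed
  have above: "A.prob {X. - real_of_int (snd (X n)) \<le> real n / m - \<epsilon> * real n} \<le> C2 / real n"
    if n: "1 \<le> n" for n
  proof -
    \<comment> \<open>For a negative threshold \<open>nat\<close> gives k = 0, where
      \<open>renewal_tail\<close> vanishes; this is the first case below.\<close>
    define k where "k = nat (\<lfloor>real n / m - \<epsilon> * real n\<rfloor> + 1)"
    have "A.prob {X. - real_of_int (snd (X n)) \<le> real n / m - \<epsilon> * real n} \<le>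
        A.prob {X. - snd (X n) < int k}"
    proof (rule A.finite_measure_mono)
      show "{X :: nat \<Rightarrow> site. - real_of_int (snd (X n)) \<le> real n / m - \<epsilon> * real n} \<subseteq> {X. - snd (X n) < int k}"
      proof (rule subsetI, unfold mem_Collect_eq)
        fix X :: "nat \<Rightarrow> site" assume "- real_of_int (snd (X n)) \<le> real n / m - \<epsilon> * real n"
        then have "- snd (X n) \<le> \<lfloor>real n / m - \<epsilon> * real n\<rfloor>" by (simp add: le_floor_iff)
        then show "- snd (X n) < int k" unfolding k_def by simp
      qed
    qed (rule sets)
    also have "\<dots> = renewal_tail p k n" by (rule snd_prob)
    finally have le: "A.prob {X. - real_of_int (snd (X n)) \<le> real n / m - \<epsilon> * real n} \<le> renewal_tail p k n" .
    have C2: "0 \<le> C2" using V \<epsilon> by (simp add: C2_def)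
    consider "k = 0" | "real n < 2 / \<epsilon>" | "0 < k" "2 / \<epsilon> \<le> real n" by force
    then show ?thesis
    proof cases
      case 1
      then show ?thesis using le C2 by (simp add: order.trans)
    next
      case 2
      have "1 \<le> (2 / \<epsilon>) / real n" using 2 n \<epsilon> by (simp add: field_simps)
      also have "\<dots> \<le> C2 / real n"
        using V by (intro divide_right_mono) (auto simp: C2_def)
      finally show ?thesis using A.prob_le_1 order.trans by blast
    next
      case 3
      have "real k \<le> real n / m - \<epsilon> * real n + 1"
        using 3(1) unfolding k_def by linarith
      then have "real k * m \<le> (real n / m - \<epsilon> * real n + 1) * m"
        using m by (intro mult_right_mono) auto
      moreover have "(real n / m - \<epsilon> * real n + 1) * m = real n - \<epsilon> * m * real n + m"
        using m by (simp add: field_simps)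
      moreover have "m \<le> \<epsilon> * m * real n / 2"
        using mult_left_mono[OF 3(2), of "\<epsilon> * m"] \<epsilon> m by (simp add: field_simps)
      ultimately have km: "\<epsilon> * m * real n / 2 \<le> real n - real k * m" by linarith
      have pos: "0 < \<epsilon> * m * real n / 2" using m \<epsilon> n by simp
      have "real k * 1 \<le> real k * m" using m by (intro mult_left_mono) auto
      then have kn: "real k \<le> real n" using km pos by linarith
      have "renewal_tail p k n \<le> real k * V / (real n - real k * m)\<^sup>2"
        using km pos by (intro V(2)) linarith
      also have "\<dots> \<le> real n * V / (\<epsilon> * m * real n / 2)\<^sup>2"
      proof (rule frac_le)
        show "real k * V \<le> real n * V"
          using kn V(1) by (rule mult_right_mono)
        show "(\<epsilon> * m * real n / 2)\<^sup>2 \<le> (real n - real k * m)\<^sup>2"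
          using km pos by (intro power_mono) auto
      qed (use n V m \<epsilon> in auto)
      also have "\<dots> = (4 * V / (\<epsilon> * m)\<^sup>2) / real n"
        using n by (simp add: power2_eq_square mult_ac)
      also have "\<dots> \<le> C2 / real n"
        using \<epsilon> by (intro divide_right_mono) (auto simp: C2_def)
      finally show ?thesis using le by linarith
    qed
  qed
  show ?thesis
  proof (intro exI allI impI)
    fix n :: nat assume n: "1 \<le> n"
    let ?B = "{X. real n / m + \<epsilon> * real n \<le> - real_of_int (snd (X n))}"
    let ?D = "{X. - real_of_int (snd (X n)) \<le> real n / m - \<epsilon> * real n}"
    have "A.prob {X. \<epsilon> * real n \<le> \<bar>- real_of_int (snd (X n)) - real n / m\<bar>} \<le> A.prob (?B \<union> ?D)"
      by (intro A.finite_measure_mono sets.Un sets) auto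
    also have "\<dots> \<le> A.prob ?B + A.prob ?D"
      by (intro measure_Un_le sets)
    also have "\<dots> \<le> (C1 + C2) / real n"
      using below[OF n] above[OF n] by (simp add: add_divide_distrib)
    finally show "A.prob {X. \<epsilon> * real n \<le> \<bar>- real_of_int (snd (X n)) - real n / mean_time p\<bar>}
        \<le> (C1 + C2) / real n"
      unfolding m_def .
  qed
qed

lemma AE_annealed_speed:
  assumes p: "0 < p" "p < 1"
  shows "AE X in annealed (step_set_law p).
    (\<lambda>n. (1 / real n) *\<^sub>R real_site (X n)) \<longlonglongrightarrow> (0, - 1 / mean_time p)"
proof -
  interpret A: prob_space "annealed (step_set_law p)" by (rule prob_space_annealed)
  let ?H = "\<lambda>n X. real_of_int (fst (X n :: site))"
  let ?Z = "\<lambda>n X. - real_of_int (snd (X n :: site)) - real n / mean_time p"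
  have m: "1 \<le> mean_time p" by (rule mean_time_ge_1[OF p])
  have step: "AE X in annealed (step_set_law p). \<forall>n. X (Suc n) - X n \<in> {(1, 0), (-1, 0), (0, -1)}"
    using AE_annealed_step by (simp add: drilled_def e1_def e2_def uminus_prod_def)
  have "AE X in annealed (step_set_law p). (\<lambda>n. ?H n X / real n) \<longlonglongrightarrow> 0"
  proof (rule A.AE_LIMSEQ_div_zero)
    show "AE X in annealed (step_set_law p). \<forall>n. \<bar>?H (Suc n) X - ?H n X\<bar> \<le> 1"
      using step
    proof eventually_elim
      case (elim X)
      show ?case
      proof
        fix n
        have "fst (X (Suc n)) - fst (X n) = fst (X (Suc n) - X n)" by simp
        also have "\<dots> \<in> {-1, 0, 1}" using elim[rule_format, of n] by (auto simp del: fst_diff)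
        finally show "\<bar>?H (Suc n) X - ?H n X\<bar> \<le> 1" by auto
      qed
    qed
    show "\<exists>C. \<forall>n\<ge>1. A.prob {X \<in> space (annealed (step_set_law p)). \<epsilon> * real n \<le> \<bar>?H n X\<bar>} \<le> C / real n"
      if \<epsilon>: "0 < \<epsilon>" for \<epsilon>
    proof (intro exI[of _ "1 / \<epsilon>\<^sup>2"] allI impI)
      fix n :: nat assume n: "1 \<le> n"
      have "A.prob {X. \<epsilon> * real n \<le> \<bar>?H n X\<bar>} \<le> real n / (\<epsilon> * real n)\<^sup>2"
        using n \<epsilon> by (intro measure_annealed_fst) auto
      also have "\<dots> = 1 / \<epsilon>\<^sup>2 / real n"
        using n by (simp add: power2_eq_square)
      finally show "A.prob {X \<in> space (annealed (step_set_law p)). \<epsilon> * real n \<le> \<bar>?H n X\<bar>} \<le> 1 / \<epsilon>\<^sup>2 / real n"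
        by (simp add: space_annealed)
    qed
  qed measurable
  moreover have "AE X in annealed (step_set_law p). (\<lambda>n. ?Z n X / real n) \<longlonglongrightarrow> 0"
  proof (rule A.AE_LIMSEQ_div_zero)
    show "AE X in annealed (step_set_law p). \<forall>n. \<bar>?Z (Suc n) X - ?Z n X\<bar> \<le> 1"
      using step
    proof eventually_elim
      case (elim X)
      show ?case
      proof
        fix n
        have "snd (X (Suc n)) - snd (X n) = snd (X (Suc n) - X n)" by simp
        also have "\<dots> \<in> {-1, 0}" using elim[rule_format, of n] by (auto simp del: snd_diff)
        finally have "- 1 \<le> real_of_int (snd (X (Suc n))) - real_of_int (snd (X n))"
          "real_of_int (snd (X (Suc n))) - real_of_int (snd (X n)) \<le> 0" by auto
        moreover have Z: "?Z (Suc n) X - ?Z n X =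
            - (real_of_int (snd (X (Suc n))) - real_of_int (snd (X n))) - 1 / mean_time p"
          by (simp add: add_divide_distrib)
        \<comment> \<open>The increment of \<open>?Z\<close> is 0 or 1 minus a number in (0,1],
          hence at most 1 in absolute value.\<close>
        moreover have "0 < 1 / mean_time p" "1 / mean_time p \<le> 1" using m by auto
        ultimately show "\<bar>?Z (Suc n) X - ?Z n X\<bar> \<le> 1"
          unfolding Z abs_le_iff by linarith
      qed
    qed
    show "\<exists>C. \<forall>n\<ge>1. A.prob {X \<in> space (annealed (step_set_law p)). \<epsilon> * real n \<le> \<bar>?Z n X\<bar>} \<le> C / real n"
      if "0 < \<epsilon>" for \<epsilon>
      using annealed_snd_deviation[OF p that] by (simp add: space_annealed)
  qed measurable
  ultimately show ?thesis
  proof eventually_elim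
    case (elim X)
    have "(\<lambda>n. - (?Z n X / real n) - 1 / mean_time p) \<longlonglongrightarrow> - 0 - 1 / mean_time p"
      using elim by (intro tendsto_intros)
    \<comment> \<open>Only eventually: at n = 0 division by zero yields 0, and the two sides differ
      by 1/m.\<close>
    moreover have "\<forall>\<^sub>F n in sequentially.
        - (?Z n X / real n) - 1 / mean_time p = real_of_int (snd (X n)) / real n"
      using eventually_gt_at_top[of 0]
      by eventually_elim (use m in \<open>simp add: field_simps\<close>)
    ultimately have "(\<lambda>n. real_of_int (snd (X n)) / real n) \<longlonglongrightarrow> - 0 - 1 / mean_time p"
      by (rule Lim_transform_eventually)
    with elim have "(\<lambda>n. (?H n X / real n, real_of_int (snd (X n)) / real n)) \<longlonglongrightarrow> (0, - 1 / mean_time p)"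
      by (intro tendsto_Pair) auto
    then show ?case by (simp add: real_site_def)
  qed
qed

lemma annealed_speed:
  assumes p: "0 < p" "p < 1"
  shows "measure (annealed (step_set_law p)) {X \<in> space (annealed (step_set_law p)).
    (\<lambda>n. (1 / real n) *\<^sub>R real_site (X n)) \<longlonglongrightarrow> (0, - 1 / mean_time p)} = 1"
proof -
  interpret A: prob_space "annealed (step_set_law p)" by (rule prob_space_annealed)
  have [measurable]: "(\<lambda>X. dist ((1 / real n) *\<^sub>R real_site (X n)) c) \<in> borel_measurable (annealed (step_set_law p))"
    for n c
    by (rule measurable_compose[OF measurable_annealed_position(1)]) simp
  \<comment> \<open>Measurability of the convergence event is what turns the almost sure statement
    into probability one.\<close>
  have "{X \<in> space (annealed (step_set_law p)).
    (\<lambda>n. (1 / real n) *\<^sub>R real_site (X n)) \<longlonglongrightarrow> (0, - 1 / mean_time p)} \<in> A.events"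
    unfolding LIMSEQ_iff_inverse_Suc by measurable
  then show ?thesis
    using AE_annealed_speed[OF p] by (subst A.prob_Collect_eq_1) auto
qed

theorem mainTheorem8:
  shows "\<exists>v :: real \<Rightarrow> real \<times> real.
    (\<forall>p\<in>{0<..<1}.
      measure (annealed (step_set_law p))
        {X \<in> space (annealed (step_set_law p)).
          (\<lambda>n. (1 / real n) *\<^sub>R real_site (X n)) \<longlonglongrightarrow> v p} = 1 \<and>
      fst (v p) = 0 \<and> snd (v p) < 0) \<and>
    strict_antimono_on {0<..<1} (\<lambda>p. snd (v p))"
proof (intro exI[of _ "\<lambda>p. (0, - 1 / mean_time p)"] conjI ballI)
  fix p :: real assume "p \<in> {0<..<1}"
  then have p: "0 < p" "p < 1" by auto
  show "measure (annealed (step_set_law p)) {X \<in> space (annealed (step_set_law p)).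
      (\<lambda>n. (1 / real n) *\<^sub>R real_site (X n)) \<longlonglongrightarrow> (0, - 1 / mean_time p)} = 1"
    by (rule annealed_speed[OF p])
  show "snd (0 :: real, - 1 / mean_time p) < 0"
    using mean_time_ge_1[OF p] by simp
next
  show "strict_antimono_on {0<..<1} (\<lambda>p. snd (0 :: real, - 1 / mean_time p))"
  proof (rule monotone_onI)
    fix p p' :: real assume "p \<in> {0<..<1}" "p' \<in> {0<..<1}" "p < p'"
    then have "mean_time p' < mean_time p" "1 \<le> mean_time p'"
      by (auto intro: mean_time_strict_antimono mean_time_ge_1)
    then show "snd (0 :: real, - 1 / mean_time p) > snd (0 :: real, - 1 / mean_time p')"
      by (simp add: divide_strict_left_mono)
  qed
qed simp

end
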